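(* For a path graph $G$ with $n$ nodes, the $k$-leader selection algorithm for coherence in a path graph (the specific algorithm described in the context) identifies the leader set $S$, with $|S|\le k$, that minimizes $R(S)$, in $O(n^3)$ operations.
   Context: Setting. The path graph has node set $V=\{1,\dots,n\}$, numbered in order along the path, with edges joining $i$ and $i+1$ for $1\le i\le n-1$ (both directions are in the edge set $E$); $N(i)$ is the set of neighbors of $i$. Each edge carries a noise parameter $\nu_{ij}=\nu_{ji}>0$. The weighted Laplacian $L\in\mathbb{R}^{n\times n}$ is $L_{ij}=-1/\nu_{ij}$ if $(i,j)\in E$, $L_{ii}=\sum_{j\in N(i)}1/\nu_{ij}$, and $L_{ij}=0$ otherwise. For a (nonempty) leader set $S\subseteq V$, $L_{ff}$ is the submatrix of $L$ obtained by deleting the rows and columns indexed by $S$, and $R(S)=\frac12\mathrm{tr}(L_{ff}^{-1})$ is the total steady-state variance of the noisy leader-follower formation with leader set $S$. The trace of the inverse of a matrix of size $0$ is $0$. The positive integer $k$ is the bound on the number of leaders. The digraph. Let $L_{[1,v)}$ be the submatrix of $L$ on rows and columns $1,\dots,v-1$; $L_{(u,v)}$ the submatrix on rows and columns $u+1,\dots,v-1$; and $L_{(v,n]}$ the submatrix on rows and columns $v+1,\dots,n$. The weighted digraph $\overline{G}$ has node set $V\cup\{s,t\}$, with an additional source node $s$ and target node $t$, and edges: $(s,v)$ for each $v\in V$ with weight $\frac12\mathrm{tr}(L_{[1,v)}^{-1})$; $(u,v)$ for all $u,v\in V$ with $u<v$, with weight $\frac12\mathrm{tr}(L_{(u,v)}^{-1})$;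 and $(v,t)$ for each $v\in V$ with weight $\frac12\mathrm{tr}(L_{(v,n]}^{-1})$. The weights of $(s,1)$, $(n,t)$ and $(u,u+1)$ are $0$. Modified Bellman-Ford. Given a weighted digraph with edge weights $w(u,v)$, a source $s$, a target $t$ and a number $H$, set $d_0(s)=0$, $d_m(s)=\infty$ for $m=1,\dots,H$, and $d_m(v)=\infty$ for $v\ne s$ and $m=0,\dots,H$. For $m=1,\dots,H$ and each node $v$, set $d_m(v)=\min_u\{d_{m-1}(u)+w(u,v)\}$ over the nodes $u$ having an edge to $v$, and record a minimizing $u$ as the predecessor $\pi_m(v)$; thus $d_m(v)$ is the minimum weight of a path from $s$ to $v$ with exactly $m$ edges. Among the computed paths from $s$ to $t$ with $m$ edges, $m=1,\dots,H$, the one of minimum weight is retrieved by following predecessors, and its node list $P$ and its weight are returned. The $k$-leader selection algorithm. Given $G$, its weights and $k$: form $L$; construct $\overline{G}$, each edge weight being obtained by computing the diagonal entries of the inverse of a tridiagonal matrix with a linear-time method; run the modified Bellman-Ford algorithm on $\overline{G}$ from $s$ to $t$ with $H=k+1$ to obtain a node list $P$ and a weight; return $S=P\setminus\{s,t\}$ and $R(S)$ equal to that weight.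
   Formalization: The O(n^3) bound is stated for k ≤ n, with one constant for all such n and k; for unbounded k it fails, since the k+1 rounds of Bellman-Ford alone cost more than k operations even when n = 1. Correctness is stated for every k ≥ 1. *)

theory Defs
  imports
    "HOL-Library.Monad_Syntax"
    "HOL-Library.Extended_Real"
    "Jordan_Normal_Form.Gauss_Jordan_Elimination"
    "Jordan_Normal_Form.DL_Submatrix"
begin

definition path_edges :: "nat \<Rightarrow> (nat \<times> nat) set" where
  "path_edges n = {(i, j). i \<in> {1..n} \<and> j \<in> {1..n} \<and> (j = i + 1 \<or> i = j + 1)}"

definition noise_weights :: "nat \<Rightarrow> (nat \<times> nat \<Rightarrow> real) \<Rightarrow> bool" where
  "noise_weights n \<nu> \<longleftrightarrow> (\<forall>(i, j) \<in> path_edges n. \<nu> (i, j) > 0 \<and> \<nu> (i, j) = \<nu> (j, i))"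

text \<open>Matrix indices start at 0, nodes at 1: row \<open>a\<close> belongs to node \<open>a + 1\<close>.\<close>

definition laplacian :: "nat \<Rightarrow> (nat \<times> nat) set \<Rightarrow> (nat \<times> nat \<Rightarrow> real) \<Rightarrow> real mat" where
  "laplacian n E \<nu> = mat n n (\<lambda>(a, b). let i = a + 1; j = b + 1 in
     if (i, j) \<in> E then - 1 / \<nu> (i, j)
     else if i = j then (\<Sum>l | (i, l) \<in> E. 1 / \<nu> (i, l))
     else 0)"

definition mat_trace :: "real mat \<Rightarrow> real" where
  "mat_trace A = (\<Sum>i < dim_row A. A $$ (i, i))"

definition L_ff :: "nat \<Rightarrow> (nat \<times> nat \<Rightarrow> real) \<Rightarrow> nat set \<Rightarrow> real mat" where
  "L_ff n \<nu> S = (let followers = {a. a + 1 \<notin> S}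
     in submatrix (laplacian n (path_edges n) \<nu>) followers followers)"

text \<open>For nonempty \<open>S\<close> the matrix is positive definite, so \<open>mat_inverse\<close> is not \<open>None\<close>.\<close>

definition total_variance :: "nat \<Rightarrow> (nat \<times> nat \<Rightarrow> real) \<Rightarrow> nat set \<Rightarrow> real" where
  "total_variance n \<nu> S = 1 / 2 * mat_trace (the (mat_inverse (L_ff n \<nu> S)))"

definition leader_set :: "nat \<Rightarrow> nat \<Rightarrow> nat set \<Rightarrow> bool" where
  "leader_set n k S \<longleftrightarrow> S \<subseteq> {1..n} \<and> S \<noteq> {} \<and> card S \<le> k"

text \<open>
  A computation is a result together with the number of operations spent on it. Each arithmetic
  operation, comparison, table read, table write and list construction costs one unit, and so
  does each loop iteration (advancing and testing the loop counter or list pointer) and each loop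
  exit. Constant offsets in table indices are part of the access. Programs below touch data only
  through these primitives; \<open>return\<close> merely passes on values already computed.
  Tables are used linearly, so that a function update stands for a destructive write.
\<close>

datatype 'a tm = TM (val: 'a) (cost: nat)

definition return :: "'a \<Rightarrow> 'a tm" where
  "return x = TM x 0"

definition bind_tm :: "'a tm \<Rightarrow> ('a \<Rightarrow> 'b tm) \<Rightarrow> 'b tm" where
  "bind_tm p f = TM (val (f (val p))) (cost p + cost (f (val p)))"

adhoc_overloading Monad_Syntax.bind == bind_tm

definition step :: "'a \<Rightarrow> 'a tm" where
  "step x = TM x 1"

definition add_tm :: "'a::plus \<Rightarrow> 'a \<Rightarrow> 'a tm" where
  "add_tm x y = step (x + y)"

definition sub_tm :: "real \<Rightarrow> real \<Rightarrow> real tm" where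
  "sub_tm x y = step (x - y)"

definition mul_tm :: "real \<Rightarrow> real \<Rightarrow> real tm" where
  "mul_tm x y = step (x * y)"

definition div_tm :: "real \<Rightarrow> real \<Rightarrow> real tm" where
  "div_tm x y = step (x / y)"

definition eq_tm :: "nat \<Rightarrow> nat \<Rightarrow> bool tm" where
  "eq_tm x y = step (x = y)"

text \<open>Should \<open>x\<close> replace \<open>y\<close> as the current minimum? The flag decides in case of a tie.\<close>

definition better_tm :: "bool \<Rightarrow> ereal \<Rightarrow> ereal \<Rightarrow> bool tm" where
  "better_tm tie x y = step (if tie then x \<le> y else x < y)"

definition get_tm :: "('i \<Rightarrow> 'a) \<Rightarrow> 'i \<Rightarrow> 'a tm" where
  "get_tm T i = step (T i)"

definition put_tm :: "('i \<Rightarrow> 'a) \<Rightarrow> 'i \<Rightarrow> 'a \<Rightarrow> ('i \<Rightarrow> 'a) tm" where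
  "put_tm T i x = step (T(i := x))"

definition cons_tm :: "'a \<Rightarrow> 'a list \<Rightarrow> 'a list tm" where
  "cons_tm x xs = step (x # xs)"

text \<open>Uninitialised memory.\<close>

definition fresh :: "'i \<Rightarrow> 'a" where
  "fresh = (\<lambda>_. undefined)"

fun foreach :: "'a list \<Rightarrow> ('a \<Rightarrow> 's \<Rightarrow> 's tm) \<Rightarrow> 's \<Rightarrow> 's tm" where
  "foreach [] body s = step s"
| "foreach (x # xs) body s = do { s \<leftarrow> step s; s \<leftarrow> body x s; foreach xs body s }"

definition form_laplacian :: "nat \<Rightarrow> (nat \<times> nat \<Rightarrow> real) \<Rightarrow> (nat \<times> nat \<Rightarrow> real) tm" where
  "form_laplacian n \<nu> = do {
     L \<leftarrow> foreach [1..<n + 1] (\<lambda>i. foreach [1..<n + 1] (\<lambda>j L. put_tm L (i, j) 0)) fresh;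
     foreach [1..<n] (\<lambda>i L. do {
       r \<leftarrow> get_tm \<nu> (i, i + 1);
       x \<leftarrow> div_tm 1 r;
       y \<leftarrow> sub_tm 0 x;
       L \<leftarrow> put_tm L (i, i + 1) y;
       L \<leftarrow> put_tm L (i + 1, i) y;
       a \<leftarrow> get_tm L (i, i);
       a \<leftarrow> add_tm a x;
       L \<leftarrow> put_tm L (i, i) a;
       a \<leftarrow> get_tm L (i + 1, i + 1);
       a \<leftarrow> add_tm a x;
       put_tm L (i + 1, i + 1) a
     }) L
   }"

text \<open>
  Diagonal of the inverse of the tridiagonal matrix formed by rows and columns
  \<open>u + 1, \<dots>, v - 1\<close> of the table \<open>T\<close> (at least one row), by Usmani's formula: entry \<open>i\<close> is
  \<open>\<theta> (i - 1) * \<phi> (i + 1) / \<theta> (v - 1)\<close>, where \<open>\<theta> i\<close> and \<open>\<phi> i\<close> are the determinants of the parts on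
  \<open>u + 1, \<dots>, i\<close> and \<open>i, \<dots>, v - 1\<close>, obtained from three-term recurrences.
\<close>

definition tridiagonal_inverse_diagonal ::
    "(nat \<times> nat \<Rightarrow> real) \<Rightarrow> nat \<Rightarrow> nat \<Rightarrow> (nat \<Rightarrow> real) tm" where
  "tridiagonal_inverse_diagonal T u v = do {
     \<theta> \<leftarrow> put_tm fresh u 1;
     a \<leftarrow> get_tm T (u + 1, u + 1);
     \<theta> \<leftarrow> put_tm \<theta> (u + 1) a;
     \<theta> \<leftarrow> foreach [u + 2..<v] (\<lambda>i \<theta>. do {
       a \<leftarrow> get_tm T (i, i);
       b \<leftarrow> get_tm T (i - 1, i);
       c \<leftarrow> get_tm T (i, i - 1);
       x \<leftarrow> get_tm \<theta> (i - 1);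
       y \<leftarrow> get_tm \<theta> (i - 2);
       p \<leftarrow> mul_tm a x;
       q \<leftarrow> mul_tm b c;
       q \<leftarrow> mul_tm q y;
       z \<leftarrow> sub_tm p q;
       put_tm \<theta> i z
     }) \<theta>;
     \<phi> \<leftarrow> put_tm fresh v 1;
     a \<leftarrow> get_tm T (v - 1, v - 1);
     \<phi> \<leftarrow> put_tm \<phi> (v - 1) a;
     \<phi> \<leftarrow> foreach (rev [u + 1..<v - 1]) (\<lambda>i \<phi>. do {
       a \<leftarrow> get_tm T (i, i);
       b \<leftarrow> get_tm T (i, i + 1);
       c \<leftarrow> get_tm T (i + 1, i);
       x \<leftarrow> get_tm \<phi> (i + 1);
       y \<leftarrow> get_tm \<phi> (i + 2);
       p \<leftarrow> mul_tm a x;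
       q \<leftarrow> mul_tm b c;
       q \<leftarrow> mul_tm q y;
       z \<leftarrow> sub_tm p q;
       put_tm \<phi> i z
     }) \<phi>;
     r \<leftarrow> get_tm \<theta> (v - 1);
     foreach [u + 1..<v] (\<lambda>i D. do {
       x \<leftarrow> get_tm \<theta> (i - 1);
       y \<leftarrow> get_tm \<phi> (i + 1);
       z \<leftarrow> mul_tm x y;
       z \<leftarrow> div_tm z r;
       put_tm D i z
     }) fresh
   }"

text \<open>
  The source is node \<open>0\<close> and the target is node \<open>n + 1\<close>. Then every edge \<open>(u, v)\<close> of the digraph,
  of whichever of the three kinds, weighs half the trace of the inverse of the Laplacian's
  submatrix on the nodes strictly between \<open>u\<close> and \<open>v\<close>.
\<close>

definition edge_weight :: "(nat \<times> nat \<Rightarrow> real) \<Rightarrow> nat \<Rightarrow> nat \<Rightarrow> real tm" where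
  "edge_weight L u v = do {
     b \<leftarrow> eq_tm (u + 1) v;
     if b then return 0 else do {
       D \<leftarrow> tridiagonal_inverse_diagonal L u v;
       x \<leftarrow> foreach [u + 1..<v] (\<lambda>i x. do { y \<leftarrow> get_tm D i; add_tm x y }) 0;
       div_tm x 2
     }
   }"

text \<open>A digraph is represented by the list of incoming edges of each node.\<close>

type_synonym digraph = "nat \<Rightarrow> (nat \<times> real) list"

definition add_edge :: "(nat \<times> nat \<Rightarrow> real) \<Rightarrow> nat \<Rightarrow> nat \<Rightarrow> digraph \<Rightarrow> digraph tm" where
  "add_edge L u v G = do {
     w \<leftarrow> edge_weight L u v;
     es \<leftarrow> get_tm G v;
     es \<leftarrow> cons_tm (u, w) es;
     put_tm G v es
   }"

definition construct_digraph :: "nat \<Rightarrow> (nat \<times> nat \<Rightarrow> real) \<Rightarrow> digraph tm" where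
  "construct_digraph n L = do {
     G \<leftarrow> foreach [0..<n + 2] (\<lambda>v G. put_tm G v []) fresh;
     G \<leftarrow> foreach [1..<n + 1] (\<lambda>v G. add_edge L 0 v G) G;
     G \<leftarrow> foreach [1..<n + 1] (\<lambda>v. foreach [1..<v] (\<lambda>u G. add_edge L u v G)) G;
     foreach [1..<n + 1] (\<lambda>v G. add_edge L v (n + 1) G) G
   }"

text \<open>
  The algorithm may choose any minimiser. These choices are parameters: \<open>tie m v u p\<close> tells
  whether \<open>u\<close> displaces an equally good predecessor \<open>p\<close> of \<open>v\<close> in round \<open>m\<close>, and \<open>tie_end m m'\<close>
  whether a path with \<open>m\<close> edges displaces an equally good one with \<open>m'\<close> edges.
  Every choice of minimisers arises in this way.
\<close>

definition candidate :: "(nat \<times> nat \<Rightarrow> ereal) \<Rightarrow> nat \<Rightarrow> nat \<Rightarrow> real \<Rightarrow> ereal tm" where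
  "candidate d m u w = do { x \<leftarrow> get_tm d (m - 1, u); add_tm x (ereal w) }"

definition relax ::
    "(nat \<Rightarrow> nat \<Rightarrow> bool) \<Rightarrow> nat \<Rightarrow> nat \<Rightarrow> (nat \<times> real) list
     \<Rightarrow> (nat \<times> nat \<Rightarrow> ereal) \<times> (nat \<times> nat \<Rightarrow> nat)
     \<Rightarrow> ((nat \<times> nat \<Rightarrow> ereal) \<times> (nat \<times> nat \<Rightarrow> nat)) tm" where
  "relax tie m v es = (\<lambda>(d, \<pi>). case es of
       [] \<Rightarrow> step (d, \<pi>)
     | (u, w) # es' \<Rightarrow> do {
         x \<leftarrow> candidate d m u w;
         (x, p) \<leftarrow> foreach es' (\<lambda>(u, w) (x, p). do {
           y \<leftarrow> candidate d m u w;
           b \<leftarrow> better_tm (tie u p) y x;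
           return (if b then (y, u) else (x, p))
         }) (x, u);
         d \<leftarrow> put_tm d (m, v) x;
         \<pi> \<leftarrow> put_tm \<pi> (m, v) p;
         return (d, \<pi>)
       })"

fun retrieve :: "(nat \<times> nat \<Rightarrow> nat) \<Rightarrow> nat \<Rightarrow> nat \<Rightarrow> nat list \<Rightarrow> nat list tm" where
  "retrieve \<pi> 0 v P = cons_tm v P"
| "retrieve \<pi> (Suc m) v P = do {
     P \<leftarrow> cons_tm v P;
     u \<leftarrow> get_tm \<pi> (Suc m, v);
     retrieve \<pi> m u P
   }"

text \<open>
  The nodes of \<open>G\<close> are \<open>0, \<dots>, N - 1\<close>. A node without incoming edges keeps its initial
  value \<open>\<infinity>\<close>, the minimum of the empty set.
\<close>

definition bellman_ford ::
    "(nat \<Rightarrow> nat \<Rightarrow> nat \<Rightarrow> nat \<Rightarrow> bool) \<Rightarrow> (nat \<Rightarrow> nat \<Rightarrow> bool)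
     \<Rightarrow> digraph \<Rightarrow> nat \<Rightarrow> nat \<Rightarrow> nat \<Rightarrow> nat \<Rightarrow> (nat list \<times> ereal) tm" where
  "bellman_ford tie tie_end G N s t H = do {
     d \<leftarrow> foreach [0..<H + 1] (\<lambda>m. foreach [0..<N] (\<lambda>v d. put_tm d (m, v) \<infinity>)) fresh;
     d \<leftarrow> put_tm d (0, s) 0;
     (d, \<pi>) \<leftarrow> foreach [1..<H + 1] (\<lambda>m. foreach [0..<N] (\<lambda>v (d, \<pi>). do {
       es \<leftarrow> get_tm G v;
       relax (tie m v) m v es (d, \<pi>)
     })) (d, fresh);
     h \<leftarrow> foreach [2..<H + 1] (\<lambda>m h. do {
       x \<leftarrow> get_tm d (m, t);
       y \<leftarrow> get_tm d (h, t);
       b \<leftarrow> better_tm (tie_end m h) x y;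
       return (if b then m else h)
     }) 1;
     P \<leftarrow> retrieve \<pi> h t [];
     x \<leftarrow> get_tm d (h, t);
     return (P, x)
   }"

definition remove_ends :: "nat \<Rightarrow> nat \<Rightarrow> nat list \<Rightarrow> nat list tm" where
  "remove_ends s t P = foreach P (\<lambda>v S. do {
     b \<leftarrow> eq_tm v s;
     c \<leftarrow> eq_tm v t;
     if b \<or> c then return S else cons_tm v S
   }) []"

definition leader_selection ::
    "(nat \<Rightarrow> nat \<Rightarrow> nat \<Rightarrow> nat \<Rightarrow> bool) \<Rightarrow> (nat \<Rightarrow> nat \<Rightarrow> bool)
     \<Rightarrow> nat \<Rightarrow> (nat \<times> nat \<Rightarrow> real) \<Rightarrow> nat \<Rightarrow> (nat list \<times> ereal) tm" where
  "leader_selection tie tie_end n \<nu> k = do {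
     L \<leftarrow> form_laplacian n \<nu>;
     G \<leftarrow> construct_digraph n L;
     (P, x) \<leftarrow> bellman_ford tie tie_end G (n + 2) 0 (n + 1) (k + 1);
     S \<leftarrow> remove_ends 0 (n + 1) P;
     return (S, x)
   }"

end

theory Submission
  imports Defs "Jordan_Normal_Form.Determinant"
begin

text \<open>
  Deleting the leaders cuts the path into segments, so \<open>L_ff\<close> is block diagonal with one block per
  segment, and \<open>R(S)\<close> is a sum of terms that depend only on two consecutive leaders. With the
  sentinels \<open>0\<close> and \<open>n + 1\<close> added to \<open>S\<close>, these terms are the weights of the edges of the digraph.
  So \<open>R(S)\<close> is the weight of the path \<open>0 \<rightarrow> v\<^sub>1 \<rightarrow> \<dots> \<rightarrow> v\<^sub>r \<rightarrow> n + 1\<close> through the leaders in increasing order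
  (\<open>total_variance_eq_path_weight\<close>). As every edge of the digraph increases the node number and
  \<open>(0, n + 1)\<close> is not an edge, leader sets with at most \<open>k\<close> elements correspond exactly to walks from \<open>0\<close> to
  \<open>n + 1\<close> with at most \<open>k + 1\<close> edges (\<open>walk_increasing\<close>, \<open>increasing_walk\<close>), and the modified
  Bellman-Ford algorithm returns a lightest one (\<open>bellman_ford_correct\<close>).

  One family of polynomials carries the linear algebra. Let \<open>c l\<close> be the conductance of the edge
  \<open>{l, l + 1}\<close>, with \<open>c 0 = c n = 0\<close>: the sentinels are then joined to the path by edges that conduct
  nothing, and all three kinds of segments can be treated alike. By the matrix-tree theorem the determinant of the
  block on the nodes strictly between \<open>u\<close> and \<open>v\<close> is the weighted number of spanning trees of the cycle that
  arises when \<open>u\<close> and \<open>v\<close> are glued together. As a spanning tree of a cycle omits one edge, this number is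
  \<open>cycle_trees c u (v - 1)\<close>, the sum over \<open>j\<close> of the product of all \<open>c l\<close> with \<open>l \<noteq> j\<close> and \<open>u \<le> l < v\<close>.
  Three facts about these sums, each derived from the definition, are then enough. They satisfy the
  three-term recurrences by which the algorithm computes \<open>\<theta>\<close> and \<open>\<phi>\<close>
  (\<open>val_tridiagonal_inverse_diagonal\<close>), they are positive as soon as one end of the segment is a
  leader, and Green's function of a segment is a quotient of them (\<open>green_inverse\<close>). Green's functions of all
  segments together form the inverse of \<open>L_ff\<close>, whose trace is thereby known
  (\<open>total_variance_eq_sum\<close>).

  The cubic bound has two sources: the digraph has \<open>O(n\<^sup>2)\<close> edges, each weighted in linear time, and
  each of the at most \<open>n + 1\<close> rounds of the Bellman-Ford algorithm scans every edge once.
\<close>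

section \<open>Spanning trees of a weighted cycle\<close>

text \<open>The weighted number of spanning trees of the cycle with edges \<open>a, \<dots>, b\<close>: such a tree omits exactly one edge \<open>j\<close>.\<close>

definition cycle_trees :: "(nat \<Rightarrow> real) \<Rightarrow> nat \<Rightarrow> nat \<Rightarrow> real" where
  "cycle_trees c a b = (\<Sum>j = a..b. \<Prod>l \<in> {a..b} - {j}. c l)"

lemma cycle_trees_same [simp]: "cycle_trees c a a = 1"
  by (simp add: cycle_trees_def)

text \<open>A spanning tree omits either the new edge or one of the old ones.\<close>

lemma cycle_trees_Suc:
  assumes "a \<le> Suc b"
  shows "cycle_trees c a (Suc b) = c (Suc b) * cycle_trees c a b + (\<Prod>l = a..b. c l)"
proof -
  have "(\<Prod>l \<in> {a..Suc b} - {j}. c l) = c (Suc b) * (\<Prod>l \<in> {a..b} - {j}. c l)"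
    if "j \<in> {a..b}" for j
  proof -
    have "{a..Suc b} - {j} = insert (Suc b) ({a..b} - {j})"
      using that by auto
    then show ?thesis by simp
  qed
  moreover have "{a..Suc b} - {Suc b} = {a..b}" by auto
  ultimately show ?thesis
    using assms by (simp add: cycle_trees_def atLeastAtMostSuc_conv sum_distrib_left)
qed

text \<open>The three-term recurrence of the leading principal minors of a tridiagonal Laplacian. It follows
  from \<open>cycle_trees_Suc\<close> because the product in that lemma can be eliminated by its own instance one
  step earlier.\<close>

lemma cycle_trees_Suc_Suc:
  assumes "a \<le> Suc b"
  shows "cycle_trees c a (Suc (Suc b))
    = (c (Suc b) + c (Suc (Suc b))) * cycle_trees c a (Suc b) - c (Suc b) * c (Suc b) * cycle_trees c a b"
proof -
  have "(\<Prod>l = a..Suc b. c l) = c (Suc b) * (\<Prod>l = a..b. c l)"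
    using assms by (simp add: atLeastAtMostSuc_conv)
  then show ?thesis
    using assms by (simp add: cycle_trees_Suc algebra_simps)
qed

text \<open>The omitted edge lies on one side of \<open>i\<close>. For \<open>i\<close> a node of the segment, the two summands divided by
  the left-hand side turn out to be the currents that leave \<open>i\<close> to the left and to the right when a unit
  current enters there.\<close>

lemma cycle_trees_split:
  assumes "a \<le> i" "0 < i" "i \<le> b"
  shows "cycle_trees c a b
    = (\<Prod>l = a..<i. c l) * cycle_trees c i b + (\<Prod>l = i..b. c l) * cycle_trees c a (i - 1)"
proof -
  have interval: "{a..b} = {a..<i} \<union> {i..b}"
    using assms by auto
  have right: "(\<Prod>l \<in> {a..b} - {j}. c l) = (\<Prod>l = a..<i. c l) * (\<Prod>l \<in> {i..b} - {j}. c l)"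
    if "j \<in> {i..b}" for j
  proof -
    have split: "{a..b} - {j} = {a..<i} \<union> ({i..b} - {j})" using assms that by auto
    show ?thesis unfolding split by (rule prod.union_disjoint) auto
  qed
  have left: "(\<Prod>l \<in> {a..b} - {j}. c l) = (\<Prod>l = i..b. c l) * (\<Prod>l \<in> {a..<i} - {j}. c l)"
    if "j \<in> {a..<i}" for j
  proof -
    have split: "{a..b} - {j} = {i..b} \<union> ({a..<i} - {j})" using assms that by auto
    show ?thesis unfolding split by (rule prod.union_disjoint) auto
  qed
  have "cycle_trees c a b = (\<Sum>j \<in> {a..<i}. \<Prod>l \<in> {a..b} - {j}. c l) + (\<Sum>j \<in> {i..b}. \<Prod>l \<in> {a..b} - {j}. c l)"
    unfolding cycle_trees_def by (subst sum.union_disjoint[symmetric]) (auto simp: interval intro: sum.cong)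
  also have "\<dots> = (\<Prod>l = i..b. c l) * (\<Sum>j \<in> {a..<i}. \<Prod>l \<in> {a..<i} - {j}. c l)
      + (\<Prod>l = a..<i. c l) * cycle_trees c i b"
    unfolding cycle_trees_def sum_distrib_left using left right by (intro arg_cong2[where f = "(+)"] sum.cong) auto
  finally have sum: "cycle_trees c a b = (\<Prod>l = i..b. c l) * (\<Sum>j \<in> {a..<i}. \<Prod>l \<in> {a..<i} - {j}. c l)
      + (\<Prod>l = a..<i. c l) * cycle_trees c i b" .
  have "{a..<i} = {a..i - 1}"
    using assms(2) by auto
  then show ?thesis
    unfolding sum by (simp add: cycle_trees_def)
qed

lemma cycle_trees_pred:
  assumes "a \<le> b"
  shows "cycle_trees c a b = c a * cycle_trees c (a + 1) b + (\<Prod>l = a+1..b. c l)"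
proof (cases "a = b")
  case True
  then show ?thesis by (simp add: cycle_trees_def)
next
  case False
  then show ?thesis
    using cycle_trees_split[of a "Suc a" b c] assms by simp
qed

text \<open>The mirror image of \<open>cycle_trees_Suc_Suc\<close>, for the trailing principal minors.\<close>

lemma cycle_trees_pred_pred:
  assumes "a + 1 \<le> b"
  shows "cycle_trees c a b
    = (c a + c (a + 1)) * cycle_trees c (a + 1) b - c (a + 1) * c (a + 1) * cycle_trees c (a + 2) b"
proof -
  have "(\<Prod>l = a+1..b. c l) = c (a + 1) * (\<Prod>l = a+2..b. c l)"
    using assms by (simp add: prod.atLeast_Suc_atMost)
  moreover have "cycle_trees c (a + 1) b = c (a + 1) * cycle_trees c (a + 2) b + (\<Prod>l = a+2..b. c l)"
    using cycle_trees_pred[of "a + 1" b c] assms by simp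
  ultimately show ?thesis
    using cycle_trees_pred[of a b c] assms by (simp add: algebra_simps)
qed

text \<open>One edge may have conductance zero, since a tree can omit it. This covers the first and the last
  segment, where the edge to the sentinel does not conduct.\<close>

lemma cycle_trees_pos:
  assumes nonneg: "\<And>l. c l \<ge> 0"
    and j: "j \<in> {a..b}"
    and pos: "\<And>l. l \<in> {a..b} - {j} \<Longrightarrow> c l > 0"
  shows "cycle_trees c a b > 0"
proof -
  have "0 < (\<Prod>l \<in> {a..b} - {j}. c l)"
    using pos by (intro prod_pos) auto
  also have "\<dots> \<le> cycle_trees c a b"
    unfolding cycle_trees_def
    using member_le_sum[of j "{a..b}" "\<lambda>j. \<Prod>l \<in> {a..b} - {j}. c l"] j nonneg
    by (auto intro: prod_nonneg)
  finally show ?thesis .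
qed

section \<open>The inverse of the grounded Laplacian\<close>

text \<open>Rows and columns are numbered by nodes, from \<open>1\<close>; \<open>c l\<close> is the conductance between \<open>l\<close> and \<open>l + 1\<close>.\<close>

definition tridiagonal :: "(nat \<Rightarrow> real) \<Rightarrow> nat \<Rightarrow> nat \<Rightarrow> real" where
  "tridiagonal c i j =
    (if i = j then c (i - 1) + c i else if j = i + 1 then - c i else if i = j + 1 then - c j else 0)"

text \<open>The value zero outside \<open>1, \<dots>, n - 1\<close> makes the diagonal entries at both ends of the path instances
  of the general formula \<open>c (i - 1) + c i\<close>.\<close>

definition conductance :: "nat \<Rightarrow> (nat \<times> nat \<Rightarrow> real) \<Rightarrow> nat \<Rightarrow> real" where
  "conductance n \<nu> l = (if 1 \<le> l \<and> l < n then 1 / \<nu> (l, l + 1) else 0)"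

lemma noise_weights_sym:
  assumes "noise_weights n \<nu>" "1 \<le> l" "l < n"
  shows "\<nu> (l, l + 1) > 0" "\<nu> (l + 1, l) = \<nu> (l, l + 1)"
proof -
  have "(l, l + 1) \<in> path_edges n"
    using assms by (auto simp: path_edges_def)
  then show "\<nu> (l, l + 1) > 0" "\<nu> (l + 1, l) = \<nu> (l, l + 1)"
    using assms(1) by (auto simp: noise_weights_def)
qed

lemma conductance_nonneg:
  "noise_weights n \<nu> \<Longrightarrow> conductance n \<nu> l \<ge> 0"
  using noise_weights_sym(1)[of n \<nu> l] by (auto simp: conductance_def)

lemma conductance_pos:
  "noise_weights n \<nu> \<Longrightarrow> 1 \<le> l \<Longrightarrow> l < n \<Longrightarrow> conductance n \<nu> l > 0"
  using noise_weights_sym(1)[of n \<nu> l] by (auto simp: conductance_def)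

lemma laplacian_entry:
  assumes \<nu>: "noise_weights n \<nu>" and ab: "a < n" "b < n"
  shows "laplacian n (path_edges n) \<nu> $$ (a, b) = tridiagonal (conductance n \<nu>) (a + 1) (b + 1)"
proof (cases "a = b")
  case True
  have no_loop: "(a + 1, a + 1) \<notin> path_edges n"
    by (auto simp: path_edges_def)
  have "{l. (a + 1, l) \<in> path_edges n} = (if a = 0 then {} else {a}) \<union> (if a + 1 = n then {} else {a + 2})"
    using ab by (auto simp: path_edges_def)
  moreover have "\<nu> (Suc a, a) = \<nu> (a, Suc a)" if "a > 0"
    using noise_weights_sym(2)[OF \<nu>, of a] that ab by simp
  ultimately have "(\<Sum>l | (a + 1, l) \<in> path_edges n. 1 / \<nu> (a + 1, l))
      = conductance n \<nu> a + conductance n \<nu> (a + 1)"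
    using ab by (auto simp: conductance_def sum.union_disjoint)
  then show ?thesis
    using True ab no_loop by (simp add: laplacian_def tridiagonal_def)
next
  case False
  have "\<nu> (b + 2, b + 1) = \<nu> (b + 1, b + 2)" if "b + 1 < n"
    using noise_weights_sym(2)[OF \<nu>, of "b + 1"] that by simp
  then show ?thesis
    using False ab by (auto simp: laplacian_def tridiagonal_def conductance_def path_edges_def)
qed

definition prev_in :: "nat set \<Rightarrow> nat \<Rightarrow> nat" where
  "prev_in A j = Max {a \<in> A. a < j}"

definition next_in :: "nat set \<Rightarrow> nat \<Rightarrow> nat" where
  "next_in A j = Min {a \<in> A. j < a}"

text \<open>The potential at node \<open>i\<close> when a unit current enters at node \<open>j\<close> and \<open>u\<close> and \<open>v\<close> are grounded. Extended by zero
  outside the segment, it can be used in sums over all followers.\<close>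

definition green :: "(nat \<Rightarrow> real) \<Rightarrow> nat \<Rightarrow> nat \<Rightarrow> nat \<Rightarrow> nat \<Rightarrow> real" where
  "green c u v j i =
    (if i \<le> u \<or> v \<le> i then 0
     else if i \<le> j then cycle_trees c u (i - 1) * (\<Prod>l = i..<j. c l) * cycle_trees c j (v - 1) / cycle_trees c u (v - 1)
     else cycle_trees c u (j - 1) * (\<Prod>l = j..<i. c l) * cycle_trees c i (v - 1) / cycle_trees c u (v - 1))"

text \<open>To the left of \<open>j\<close> the current is the same through every edge, as no current enters there
  (Kirchhoff); this includes the edge at the grounded node \<open>u\<close>.\<close>

lemma green_flow_left:
  assumes "u \<le> i" "i < j" "j < v"
  shows "c i * (green c u v j (i + 1) - green c u v j i)
    = (\<Prod>l = u..<j. c l) * cycle_trees c j (v - 1) / cycle_trees c u (v - 1)"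
proof (cases "i = u")
  case True
  then show ?thesis
    using assms by (simp add: green_def prod.atLeast_Suc_lessThan)
next
  case False
  have "cycle_trees c u i = c i * cycle_trees c u (i - 1) + (\<Prod>l = u..<i. c l)"
    using cycle_trees_Suc[of u "i - 1" c] False assms
    by (simp flip: atLeastLessThanSuc_atLeastAtMost)
  moreover have "(\<Prod>l = u..<j. c l) = (\<Prod>l = u..<i. c l) * (c i * (\<Prod>l = i+1..<j. c l))"
    using prod.atLeastLessThan_concat[of u i j c] prod.atLeast_Suc_lessThan[of i j c] assms by simp
  moreover have "(\<Prod>l = i..<j. c l) = c i * (\<Prod>l = i+1..<j. c l)"
    using assms by (simp add: prod.atLeast_Suc_lessThan)
  ultimately show ?thesis
    using False assms by (simp add: green_def field_simps add_divide_distrib)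
qed

lemma green_flow_right:
  assumes "u < j" "j \<le> i" "i < v"
  shows "c i * (green c u v j i - green c u v j (i + 1))
    = cycle_trees c u (j - 1) * (\<Prod>l = j..<v. c l) / cycle_trees c u (v - 1)"
proof (cases "i + 1 = v")
  case True
  then have "green c u v j i = cycle_trees c u (j - 1) * (\<Prod>l = j..<i. c l) / cycle_trees c u (v - 1)"
    using assms by (auto simp: green_def)
  then show ?thesis
    using assms True by (auto simp: green_def)
next
  case False
  have "cycle_trees c i (v - 1) = c i * cycle_trees c (i + 1) (v - 1) + (\<Prod>l = i+1..<v. c l)"
    using cycle_trees_pred[of i "v - 1" c] False assms
    by (simp flip: atLeastLessThanSuc_atLeastAtMost)
  moreover have "(\<Prod>l = j..<v. c l) = (\<Prod>l = j..<i. c l) * (c i * (\<Prod>l = i+1..<v. c l))"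
    using prod.atLeastLessThan_concat[of j i v c] prod.atLeast_Suc_lessThan[of i v c] assms by simp
  moreover have "green c u v j i = cycle_trees c u (j - 1) * (\<Prod>l = j..<i. c l) * cycle_trees c i (v - 1) / cycle_trees c u (v - 1)"
    using assms by (auto simp: green_def)
  moreover have "green c u v j (i + 1) = cycle_trees c u (j - 1) * ((\<Prod>l = j..<i. c l) * c i) * cycle_trees c (i + 1) (v - 1) / cycle_trees c u (v - 1)"
    using assms False by (auto simp: green_def)
  ultimately show ?thesis
    using False assms by (simp add: field_simps add_divide_distrib)
qed

text \<open>Currents balance at every node other than \<open>j\<close>; at \<open>j\<close>, what leaves to both sides adds up to one by
  \<open>cycle_trees_split\<close>.\<close>

lemma green_inverse:
  assumes "u < j" "j < v" "u < i" "i < v" "cycle_trees c u (v - 1) \<noteq> 0"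
  shows "c i * (green c u v j i - green c u v j (i + 1)) + c (i - 1) * (green c u v j i - green c u v j (i - 1))
    = (if i = j then 1 else 0)"
proof -
  define fl where "fl = (\<Prod>l = u..<j. c l) * cycle_trees c j (v - 1) / cycle_trees c u (v - 1)"
  define fr where "fr = cycle_trees c u (j - 1) * (\<Prod>l = j..<v. c l) / cycle_trees c u (v - 1)"
  have L: "c i * (green c u v j (i + 1) - green c u v j i) = fl" if "u \<le> i" "i < j" for i
    using green_flow_left[OF that assms(2)] by (simp add: fl_def)
  have R: "c i * (green c u v j i - green c u v j (i + 1)) = fr" if "j \<le> i" "i < v" for i
    using green_flow_right[OF assms(1) that] by (simp add: fr_def)
  have "{j..v - 1} = {j..<v}" using assms by auto
  then have "cycle_trees c u (v - 1) = (\<Prod>l = u..<j. c l) * cycle_trees c j (v - 1) + cycle_trees c u (j - 1) * (\<Prod>l = j..<v. c l)"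
    using cycle_trees_split[of u j "v - 1" c] assms(1-2) by simp
  then have one: "fl + fr = 1"
    using assms(5) by (simp add: fl_def fr_def flip: add_divide_distrib)
  consider "i < j" | "i = j" | "i > j" by linarith
  then show ?thesis
  proof cases
    case 1
    then show ?thesis using L[of i] L[of "i - 1"] assms by (simp add: algebra_simps)
  next
    case 2
    then show ?thesis using R[of i] L[of "i - 1"] one assms by (simp add: algebra_simps)
  next
    case 3
    then show ?thesis using R[of i] R[of "i - 1"] assms by (simp add: algebra_simps)
  qed
qed

text \<open>\<open>pick\<close> enumerates the rows that are kept in a submatrix, so sums over the rows of a submatrix
  become sums over the original indices.\<close>

lemma bij_betw_pick:
  "bij_betw (pick I) {..<card {a. a < n \<and> a \<in> I}} {a. a < n \<and> a \<in> I}"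
proof -
  let ?J = "{a. a < n \<and> a \<in> I}"
  have fin: "finite ?J" by simp
  have card: "card ?J \<le> card I \<or> infinite I"
    by (auto intro: card_mono)
  have "inj_on (pick I) {..<card ?J}"
  proof (rule inj_onI)
    fix x y assume "x \<in> {..<card ?J}" "y \<in> {..<card ?J}" "pick I x = pick I y"
    moreover have "card {a \<in> I. a < pick I x} = x" if "x \<in> {..<card ?J}" for x
      using that card by (intro card_pick) auto
    ultimately show "x = y" by (metis (no_types))
  qed
  moreover have "pick I ` {..<card ?J} \<subseteq> ?J"
    using card pick_le[of _ n I] by (auto intro!: pick_in_set)
  ultimately show ?thesis
    using fin by (simp add: bij_betw_def card_image card_subset_eq)
qed

text \<open>A one-sided inverse given by a function on the original indices suffices: for square matrices over a
  field it is two-sided, hence the result of Gauss-Jordan elimination.\<close>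

lemma trace_inverse_submatrix:
  fixes A :: "real mat"
  assumes A: "A \<in> carrier_mat n n"
    and inv: "\<And>i j. i < n \<Longrightarrow> i \<in> I \<Longrightarrow> j < n \<Longrightarrow> j \<in> I \<Longrightarrow>
      (\<Sum>l | l < n \<and> l \<in> I. A $$ (i, l) * g l j) = (if i = j then 1 else 0)"
  shows "mat_trace (the (mat_inverse (submatrix A I I))) = (\<Sum>i | i < n \<and> i \<in> I. g i i)"
proof -
  define J where "J = {a. a < n \<and> a \<in> I}"
  define m where "m = card J"
  define M where "M = submatrix A I I"
  define B where "B = mat m m (\<lambda>(a, b). g (pick I a) (pick I b))"
  have bij: "bij_betw (pick I) {..<m} J"
    unfolding m_def J_def by (rule bij_betw_pick)
  then have pick: "pick I a \<in> J" if "a < m" for a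
    using that by (auto simp: bij_betw_def)
  have M: "M = mat m m (\<lambda>(a, b). A $$ (pick I a, pick I b))"
    using A by (simp add: M_def submatrix_def m_def J_def)
  then have M_carrier: "M \<in> carrier_mat m m" by simp
  have "M * B = 1\<^sub>m m"
  proof (rule eq_matI)
    fix a b assume "a < dim_row (1\<^sub>m m :: real mat)" "b < dim_col (1\<^sub>m m :: real mat)"
    then have ab: "a < m" "b < m" by auto
    have "(M * B) $$ (a, b) = (\<Sum>l < m. A $$ (pick I a, pick I l) * g (pick I l) (pick I b))"
      using ab by (simp add: M B_def scalar_prod_def atLeast0LessThan)
    also have "\<dots> = (\<Sum>l \<in> J. A $$ (pick I a, l) * g l (pick I b))"
      by (rule sum.reindex_bij_betw[OF bij])
    also have "\<dots> = (if pick I a = pick I b then 1 else 0)"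
      using inv[of "pick I a" "pick I b"] pick ab by (auto simp: J_def)
    also have "\<dots> = (if a = b then 1 else 0)"
      using bij ab by (auto simp: bij_betw_def inj_on_def)
    finally show "(M * B) $$ (a, b) = 1\<^sub>m m $$ (a, b)"
      using ab by simp
  qed (auto simp: M B_def)
  then have BM: "B * M = 1\<^sub>m m"
    by (intro mat_mult_left_right_inverse[OF M_carrier]) (auto simp: B_def)
  have "M \<in> Units (ring_mat TYPE(real) m b)" for b :: nat
    unfolding Units_def using M_carrier \<open>M * B = 1\<^sub>m m\<close> BM
    by (auto simp: ring_mat_def B_def intro!: exI[of _ B])
  then obtain C where C: "mat_inverse M = Some C"
    using mat_inverse(1)[OF M_carrier] by fastforce
  then have "C * M = 1\<^sub>m m" "C \<in> carrier_mat m m" "M * C = 1\<^sub>m m"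
    using mat_inverse(2)[OF M_carrier] by auto
  then have "C = B"
    using assoc_mult_mat[OF _ M_carrier, of C m B m] \<open>M * B = 1\<^sub>m m\<close>
    by (metis B_def left_mult_one_mat mat_carrier right_mult_one_mat)
  then have "mat_trace (the (mat_inverse M)) = (\<Sum>a < m. g (pick I a) (pick I a))"
    by (simp add: C mat_trace_def B_def)
  also have "\<dots> = (\<Sum>i \<in> J. g i i)"
    by (rule sum.reindex_bij_betw[OF bij])
  finally show ?thesis
    by (simp add: M_def J_def)
qed

section \<open>The variance as the weight of a path\<close>

text \<open>Half the trace of the inverse of the block strictly between \<open>u\<close> and \<open>v\<close> when that block is invertible, in
  the form that both Usmani's formula and Green's function yield: the diagonal entry at \<open>j\<close> is the product
  of the minors on either side of \<open>j\<close>, divided by the determinant.\<close>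

definition segment_variance :: "(nat \<Rightarrow> real) \<Rightarrow> nat \<Rightarrow> nat \<Rightarrow> real" where
  "segment_variance c u v =
    (\<Sum>j = u+1..<v. cycle_trees c u (j - 1) * cycle_trees c j (v - 1) / cycle_trees c u (v - 1)) / 2"

fun path_weight :: "(nat \<Rightarrow> nat \<Rightarrow> real) \<Rightarrow> nat list \<Rightarrow> real" where
  "path_weight w (u # v # P) = w u v + path_weight w (v # P)"
| "path_weight w _ = 0"

lemma path_weight_snoc:
  "path_weight w (P @ [u, v]) = path_weight w (P @ [u]) + w u v"
  by (induction w P rule: path_weight.induct) auto

lemma prev_in_props:
  assumes "finite A" "a \<in> A" "a < j"
  shows "prev_in A j \<in> A" "prev_in A j < j" "a \<le> prev_in A j"
proof -
  have "prev_in A j \<in> {a \<in> A. a < j}"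
    unfolding prev_in_def using assms by (intro Max_in) auto
  then show "prev_in A j \<in> A" "prev_in A j < j" by auto
  show "a \<le> prev_in A j"
    unfolding prev_in_def using assms by (intro Max_ge) auto
qed

lemma next_in_props:
  assumes "finite A" "a \<in> A" "j < a"
  shows "next_in A j \<in> A" "j < next_in A j" "next_in A j \<le> a"
proof -
  have "next_in A j \<in> {a \<in> A. j < a}"
    unfolding next_in_def using assms by (intro Min_in) auto
  then show "next_in A j \<in> A" "j < next_in A j" by auto
  show "next_in A j \<le> a"
    unfolding next_in_def using assms by (intro Min_le) auto
qed

text \<open>Column \<open>j\<close> of the inverse of \<open>L_ff\<close> is Green's function of the segment of \<open>j\<close>. It vanishes at every
  leader, so the product of a row of \<open>L_ff\<close> with it is the product of a full row of the Laplacian with it;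
  and a row of another segment meets only zeros.\<close>

lemma total_variance_eq_sum:
  assumes \<nu>: "noise_weights n \<nu>" and S: "S \<subseteq> {1..n}" "S \<noteq> {}"
  defines "A \<equiv> insert 0 (insert (n + 1) S)" and "c \<equiv> conductance n \<nu>"
  shows "total_variance n \<nu> S = 1 / 2 * (\<Sum>j \<in> {1..n} - S.
    cycle_trees c (prev_in A j) (j - 1) * cycle_trees c j (next_in A j - 1) / cycle_trees c (prev_in A j) (next_in A j - 1))"
proof -
  define I where "I = {a. a + 1 \<notin> S}"
  define g where "g l j = green c (prev_in A (j + 1)) (next_in A (j + 1)) (j + 1) (l + 1)" for l j
  have fin: "finite A"
    using S by (auto simp: A_def intro: finite_subset)
  have ends: "0 \<in> A" "n + 1 \<in> A"
    by (auto simp: A_def)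
  have inverse: "(\<Sum>l | l < n \<and> l \<in> I. laplacian n (path_edges n) \<nu> $$ (i, l) * g l j) = (if i = j then 1 else 0)"
    if ij: "i < n" "i \<in> I" "j < n" "j \<in> I" for i j
  proof -
    have j_lt: "j + 1 < n + 1" using ij by simp
    define u v G where "u = prev_in A (j + 1)" and "v = next_in A (j + 1)" and "G = green c u v (j + 1)"
    have u: "u \<in> A" "u < j + 1" "\<And>a. a \<in> A \<Longrightarrow> a < j + 1 \<Longrightarrow> a \<le> u"
      unfolding u_def using prev_in_props[OF fin] zero_less_Suc[of j] ends(1) by (auto simp del: zero_less_Suc)
    have v: "v \<in> A" "j + 1 < v" "\<And>a. a \<in> A \<Longrightarrow> j + 1 < a \<Longrightarrow> v \<le> a"
      unfolding v_def using next_in_props[OF fin] ends(2) j_lt by auto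
    have v_le: "v \<le> n + 1"
      using v(3)[of "n + 1"] ij by (auto simp: A_def)
    have j_notin: "j + 1 \<notin> A"
      using ij by (auto simp: I_def A_def)
    have G_0: "G a = 0" if "a \<in> A" for a
      using u(3)[of a] v(3)[of a] that j_notin by (cases "a < j + 1") (auto simp: G_def green_def)
    have "(\<Sum>l | l < n \<and> l \<in> I. laplacian n (path_edges n) \<nu> $$ (i, l) * g l j)
        = (\<Sum>l | l < n \<and> l \<in> I. tridiagonal c (i + 1) (l + 1) * G (l + 1))"
      using ij by (intro sum.cong) (auto simp: laplacian_entry[OF \<nu>] c_def g_def G_def u_def v_def)
    also have "\<dots> = (\<Sum>l \<in> (\<lambda>l. l + 1) ` {l. l < n \<and> l \<in> I}. tridiagonal c (i + 1) l * G l)"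
      by (simp add: sum.reindex inj_on_def)
    also have "\<dots> = (\<Sum>l = 0..n + 1. tridiagonal c (i + 1) l * G l)"
    proof (rule sum.mono_neutral_left)
      show "\<forall>l \<in> {0..n + 1} - (\<lambda>l. l + 1) ` {l. l < n \<and> l \<in> I}. tridiagonal c (i + 1) l * G l = 0"
      proof
        fix l assume l: "l \<in> {0..n + 1} - (\<lambda>l. l + 1) ` {l. l < n \<and> l \<in> I}"
        have "l \<in> A"
        proof (rule ccontr)
          assume "l \<notin> A"
          then have "l = (l - 1) + 1" "l - 1 < n" "l - 1 \<in> I"
            using l by (auto simp: A_def I_def)
          then show False using l by blast
        qed
        then show "tridiagonal c (i + 1) l * G l = 0" by (simp add: G_0)
      qed
    qed auto
    \<comment> \<open>Matrix row \<open>i\<close> belongs to node \<open>i + 1\<close>, whose neighbours are \<open>i\<close> and \<open>i + 2\<close>.\<close>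
    also have "\<dots> = (\<Sum>l \<in> {i, i + 1, i + 2}. tridiagonal c (i + 1) l * G l)"
      using ij by (intro sum.mono_neutral_right) (auto simp: tridiagonal_def)
    also have "\<dots> = c (i + 1) * (G (i + 1) - G (i + 2)) + c i * (G (i + 1) - G i)"
      by (simp add: tridiagonal_def algebra_simps)
    also have "\<dots> = (if i = j then 1 else 0)"
    proof (cases "u < i + 1 \<and> i + 1 < v")
      case True
      \<comment> \<open>In the first segment the omitted edge is the one to the sentinel \<open>0\<close>; since some leader exists,
        the segment then ends before the sentinel \<open>n + 1\<close>. In all other segments it is the last edge.\<close>
      obtain a where a: "a \<in> {u..v - 1}" "\<And>l. l \<in> {u..v - 1} - {a} \<Longrightarrow> c l > 0"
      proof (cases "u = 0")
        case True
        obtain s where s: "s \<in> S" using S by blast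
        with S have "s \<in> A" "0 < s" "s \<le> n" by (auto simp: A_def)
        then have "v \<le> s"
          using u(3)[of s] v(3)[of s] j_notin True by (cases "s < j + 1") (auto simp: not_less le_less)
        with \<open>s \<le> n\<close> have "v - 1 < n" using v(2) by linarith
        then show thesis
          using True \<nu> by (intro that[of 0]) (auto simp: c_def conductance_pos)
      next
        case False
        then show thesis
          using \<nu> v_le u(2) v(2) by (intro that[of "v - 1"]) (auto simp: c_def conductance_pos)
      qed
      then have "cycle_trees c u (v - 1) > 0"
        using conductance_nonneg[OF \<nu>] by (intro cycle_trees_pos[of c a]) (auto simp: c_def)
      then show ?thesis
        using green_inverse[of u "j + 1" v "i + 1" c] True u(2) v(2) by (simp add: G_def)
    next
      case False
      moreover have "i + 1 \<notin> A"
        using ij by (auto simp: I_def A_def)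
      then have "i + 1 \<noteq> u" "i + 1 \<noteq> v"
        using u(1) v(1) by auto
      ultimately have "i + 1 < u \<or> v < i + 1" by linarith
      then show ?thesis
        using u(2) v(2) by (auto simp: G_def green_def)
    qed
    finally show ?thesis .
  qed
  have "mat_trace (the (mat_inverse (L_ff n \<nu> S))) = (\<Sum>i | i < n \<and> i \<in> I. g i i)"
    unfolding L_ff_def Let_def I_def[symmetric]
    by (rule trace_inverse_submatrix[OF _ inverse]) (auto simp: laplacian_def)
  also have "\<dots> = (\<Sum>j \<in> (\<lambda>i. i + 1) ` {i. i < n \<and> i \<in> I}. green c (prev_in A j) (next_in A j) j j)"
    by (simp add: sum.reindex inj_on_def g_def)
  also have "(\<lambda>i. i + 1) ` {i. i < n \<and> i \<in> I} = {1..n} - S"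
  proof (intro equalityI subsetI)
    fix j assume "j \<in> {1..n} - S"
    then show "j \<in> (\<lambda>i. i + 1) ` {i. i < n \<and> i \<in> I}"
      by (intro image_eqI[of _ _ "j - 1"]) (auto simp: I_def)
  qed (auto simp: I_def)
  also have "(\<Sum>j \<in> {1..n} - S. green c (prev_in A j) (next_in A j) j j) = (\<Sum>j \<in> {1..n} - S.
    cycle_trees c (prev_in A j) (j - 1) * cycle_trees c j (next_in A j - 1) / cycle_trees c (prev_in A j) (next_in A j - 1))"
  proof (rule sum.cong)
    fix j assume "j \<in> {1..n} - S"
    then have "prev_in A j < j" "j < next_in A j"
      using prev_in_props(2)[OF fin, of 0 j] next_in_props(2)[OF fin, of "n + 1" j] by (auto simp: A_def)
    then show "green c (prev_in A j) (next_in A j) j j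
        = cycle_trees c (prev_in A j) (j - 1) * cycle_trees c j (next_in A j - 1) / cycle_trees c (prev_in A j) (next_in A j - 1)"
      by (simp add: green_def)
  qed auto
  finally show ?thesis
    by (simp add: total_variance_def)
qed

text \<open>The gaps of an increasing list partition the nodes outside the list, and within a gap the neighbours
  in the list are its two ends.\<close>

lemma path_weight_eq_sum:
  assumes "sorted_wrt (<) (x # xs)" and w: "\<And>u v. w u v = (\<Sum>j = u+1..<v. f u v j)"
  shows "path_weight w (x # xs)
    = (\<Sum>j \<in> {x..last (x # xs)} - set (x # xs). f (prev_in (set (x # xs)) j) (next_in (set (x # xs)) j) j)"
  using assms(1)
proof (induction xs arbitrary: x)
  case Nil
  then show ?case by simp
next
  case (Cons y ys)
  let ?A = "set (y # ys)" and ?l = "last (y # ys)"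
  have xy: "x < y" "\<And>z. z \<in> ?A \<Longrightarrow> y \<le> z" and sorted: "sorted_wrt (<) (y # ys)"
    using Cons.prems by auto
  have l: "y \<le> ?l"
    using xy(2) by (metis last_in_set list.distinct(1))
  have split: "{x..?l} - insert x ?A = {x+1..<y} \<union> ({y..?l} - ?A)"
  proof (intro equalityI subsetI)
    fix z assume "z \<in> {x+1..<y} \<union> ({y..?l} - ?A)"
    then show "z \<in> {x..?l} - insert x ?A"
      using xy(1) xy(2)[of z] l by (cases "z < y") auto
  qed auto
  have first: "prev_in (insert x ?A) j = x" "next_in (insert x ?A) j = y" if "j \<in> {x+1..<y}" for j
  proof -
    have "{a \<in> insert x ?A. a < j} = {x}"
      using that xy(2) by force
    then show "prev_in (insert x ?A) j = x" by (simp add: prev_in_def)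
    have "y \<in> {a \<in> insert x ?A. j < a}" "\<And>z. z \<in> {a \<in> insert x ?A. j < a} \<Longrightarrow> y \<le> z"
      using that xy(2) by auto
    then show "next_in (insert x ?A) j = y"
      unfolding next_in_def by (intro Min_eqI) auto
  qed
  have rest: "prev_in (insert x ?A) j = prev_in ?A j" "next_in (insert x ?A) j = next_in ?A j"
    if "j \<in> {y..?l} - ?A" for j
  proof -
    have yj: "y < j" using that by (auto simp: le_less)
    have "x < prev_in ?A j"
      using prev_in_props(3)[of ?A y j] yj xy(1) by simp
    moreover have "{a \<in> insert x ?A. a < j} = insert x {a \<in> ?A. a < j}"
      using yj xy(1) by auto
    ultimately show "prev_in (insert x ?A) j = prev_in ?A j"
      unfolding prev_in_def using yj by (subst \<open>_ = insert x _\<close>, subst Max_insert) auto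
    have "{a \<in> insert x ?A. j < a} = {a \<in> ?A. j < a}"
      using yj xy(1) by auto
    then show "next_in (insert x ?A) j = next_in ?A j"
      by (simp only: next_in_def)
  qed
  have "(\<Sum>j \<in> {x..?l} - insert x ?A. f (prev_in (insert x ?A) j) (next_in (insert x ?A) j) j)
      = (\<Sum>j = x+1..<y. f x y j) + (\<Sum>j \<in> {y..?l} - ?A. f (prev_in ?A j) (next_in ?A j) j)"
    unfolding split
    by (subst sum.union_disjoint) (use first rest in \<open>auto intro!: sum.cong arg_cong2[where f = "(+)"]\<close>)
  then show ?case
    using Cons.IH[OF sorted] by (simp add: w)
qed

lemma total_variance_eq_path_weight:
  assumes "noise_weights n \<nu>" "sorted_wrt (<) P" "P \<noteq> []" "hd P = 0" "last P = n + 1"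
    and "set P - {0, n + 1} \<noteq> {}"
  shows "total_variance n \<nu> (set P - {0, n + 1}) = path_weight (segment_variance (conductance n \<nu>)) P"
proof -
  let ?S = "set P - {0, n + 1}"
  define f where "f u v j = cycle_trees (conductance n \<nu>) u (j - 1) * cycle_trees (conductance n \<nu>) j (v - 1)
    / cycle_trees (conductance n \<nu>) u (v - 1) / 2" for u v j
  have w: "segment_variance (conductance n \<nu>) u v = (\<Sum>j = u+1..<v. f u v j)" for u v
    by (simp add: segment_variance_def f_def sum_divide_distrib)
  obtain xs where P: "P = 0 # xs"
    using assms(3,4) by (cases P) auto
  have ends: "0 \<in> set P" "n + 1 \<in> set P"
    using assms(3-5) hd_in_set[of P] last_in_set[of P] by auto
  have le: "z \<le> n + 1" if z: "z \<in> set P" for z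
  proof -
    obtain i where "i < length P" "P ! i = z"
      using z by (auto simp: in_set_conv_nth)
    moreover have "sorted P"
      using assms(2) strict_sorted_imp_sorted by blast
    ultimately have "z \<le> P ! (length P - 1)"
      by (auto intro!: sorted_nth_mono)
    then show ?thesis
      using assms(3,5) by (simp add: last_conv_nth)
  qed
  then have S: "?S \<subseteq> {1..n}" by fastforce
  have A: "insert 0 (insert (n + 1) ?S) = set P"
    using ends by auto
  have range: "{0..n + 1} - set P = {1..n} - ?S"
    using ends by (auto simp: le_Suc_eq Suc_le_eq intro: gr0I)
  have "path_weight (segment_variance (conductance n \<nu>)) P
      = (\<Sum>j \<in> {0..n + 1} - set P. f (prev_in (set P) j) (next_in (set P) j) j)"
    using path_weight_eq_sum[OF _ w, of 0 xs] assms(2,5) by (simp add: P)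
  also have "\<dots> = (\<Sum>j \<in> {1..n} - ?S. f (prev_in (set P) j) (next_in (set P) j) j)"
    unfolding range ..
  also have "\<dots> = total_variance n \<nu> ?S"
    unfolding total_variance_eq_sum[OF assms(1) S assms(6)] A by (simp add: f_def sum_divide_distrib)
  finally show ?thesis by simp
qed

section \<open>Usmani's recurrences and the construction of the digraph\<close>

lemma val_simps [simp]:
  "val (return x) = x" "val (step x) = x" "val (bind_tm p f) = val (f (val p))"
  "val (add_tm a b) = a + b" "val (sub_tm r s) = r - s" "val (mul_tm r s) = r * s" "val (div_tm r s) = r / s"
  "val (eq_tm k l) = (k = l)" "val (better_tm tie y z) = (if tie then y \<le> z else y < z)"
  "val (get_tm T i) = T i" "val (put_tm T i x) = T(i := x)" "val (cons_tm x xs) = x # xs"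
  for a b :: "'b :: plus"
  by (simp_all add: return_def step_def bind_tm_def add_tm_def sub_tm_def mul_tm_def div_tm_def
      eq_tm_def better_tm_def get_tm_def put_tm_def cons_tm_def)

lemma val_foreach [simp]: "val (foreach xs body s) = fold (\<lambda>x s. val (body x s)) xs s"
  by (induction xs arbitrary: s) auto

lemma fold_upt_invariant:
  assumes "a \<le> b" "I a s" "\<And>i s. a \<le> i \<Longrightarrow> i < b \<Longrightarrow> I i s \<Longrightarrow> I (Suc i) (f i s)"
  shows "I b (fold f [a..<b] s)"
  using assms by (induction b rule: dec_induct) auto

lemma fold_rev_upt_invariant:
  assumes "a \<le> b" "I b s" "\<And>i s. a \<le> i \<Longrightarrow> i < b \<Longrightarrow> I (Suc i) s \<Longrightarrow> I i (f i s)"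
  shows "I a (fold f (rev [a..<b]) s)"
  using assms
proof (induction "b - a" arbitrary: b s)
  case (Suc k)
  then obtain b' where b: "b = Suc b'" "a \<le> b'" by (cases b) auto
  then have "k = b' - a" using Suc.hyps(2) by simp
  then have "I a (fold f (rev [a..<b']) (f b' s))"
    using Suc.prems b by (intro Suc.hyps(1)) auto
  then show ?case using b by simp
qed auto

lemma fold_update: "fold (\<lambda>x T. T(x := g x)) xs T = (\<lambda>x. if x \<in> set xs then g x else T x)"
  by (induction xs arbitrary: T) auto

lemma fold_fold_update:
  "fold (\<lambda>x. fold (\<lambda>y T. T((x, y) := z)) ys) xs T = (\<lambda>p. if p \<in> set xs \<times> set ys then z else T p)"
proof (induction xs arbitrary: T)
  case (Cons x xs)
  have row: "fold (\<lambda>y T. T((x, y) := z)) ys T = (\<lambda>p. if p \<in> {x} \<times> set ys then z else T p)" for T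
    by (induction ys arbitrary: T) auto
  show ?case
    by (simp only: fold.simps o_apply Cons.IH row) (auto simp: fun_eq_iff)
qed auto

lemma fold_add: "fold (\<lambda>x s. s + f x) xs s = s + sum_list (map f xs)"
  for s :: "'a :: monoid_add"
  by (induction xs arbitrary: s) (auto simp: add.assoc)

text \<open>Before round \<open>m\<close> the table holds the Laplacian of the path in which only the edges left of \<open>m\<close> conduct,
  that is, of \<open>conductance m \<nu>\<close>. This makes the invariant an instance of the claim.\<close>

lemma val_form_laplacian:
  assumes "1 \<le> n" "i \<in> {1..n}" "j \<in> {1..n}"
  shows "val (form_laplacian n \<nu>) (i, j) = tridiagonal (conductance n \<nu>) i j"
proof -
  define body where "body = (\<lambda>m (L :: nat \<times> nat \<Rightarrow> real). let x = 1 / \<nu> (m, m + 1);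
      L = L((m, m + 1) := 0 - x, (m + 1, m) := 0 - x); L = L((m, m) := L (m, m) + x)
    in L((m + 1, m + 1) := L (m + 1, m + 1) + x))"
  define Z :: "nat \<times> nat \<Rightarrow> real" where
    "Z = (\<lambda>p. if p \<in> set [1..<n + 1] \<times> set [1..<n + 1] then 0 else fresh p)"
  have "val (form_laplacian n \<nu>) = fold body [1..<n] Z"
    by (simp add: form_laplacian_def Z_def fold_fold_update body_def Let_def del: upt_Suc)
  moreover have "\<forall>i \<in> {1..n}. \<forall>j \<in> {1..n}. fold body [1..<n] Z (i, j) = tridiagonal (conductance n \<nu>) i j"
  proof (rule fold_upt_invariant[where I = "\<lambda>m L. \<forall>i \<in> {1..n}. \<forall>j \<in> {1..n}. L (i, j) = tridiagonal (conductance m \<nu>) i j"])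
    show "\<forall>i \<in> {1..n}. \<forall>j \<in> {1..n}. Z (i, j) = tridiagonal (conductance 1 \<nu>) i j"
      by (auto simp: Z_def tridiagonal_def conductance_def)
  next
    fix m and L :: "nat \<times> nat \<Rightarrow> real"
    assume m: "1 \<le> m" "m < n" and L: "\<forall>i \<in> {1..n}. \<forall>j \<in> {1..n}. L (i, j) = tridiagonal (conductance m \<nu>) i j"
    have c: "conductance (Suc m) \<nu> = (conductance m \<nu>)(m := 1 / \<nu> (m, m + 1))"
      and c0: "conductance m \<nu> m = 0"
      using m by (auto simp: conductance_def)
    show "\<forall>i \<in> {1..n}. \<forall>j \<in> {1..n}. body m L (i, j) = tridiagonal (conductance (Suc m) \<nu>) i j"
      using m L by (auto simp: c c0 body_def Let_def tridiagonal_def)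
  qed (use assms in auto)
  ultimately show ?thesis using assms by simp
qed

text \<open>Usmani's \<open>\<theta> i\<close> is \<open>cycle_trees c u i\<close>, and \<open>\<phi> i\<close> is \<open>cycle_trees c (i - 1) (v - 1)\<close>: the block on the
  nodes \<open>i, \<dots>, v - 1\<close> is bounded by \<open>i - 1\<close> and \<open>v\<close>.\<close>

lemma val_tridiagonal_inverse_diagonal:
  assumes T: "\<And>i j. i \<in> {u<..<v} \<Longrightarrow> j \<in> {u<..<v} \<Longrightarrow> T (i, j) = tridiagonal c i j"
    and i: "i \<in> {u<..<v}"
  shows "val (tridiagonal_inverse_diagonal T u v) i
    = cycle_trees c u (i - 1) * cycle_trees c i (v - 1) / cycle_trees c u (v - 1)"
proof -
  have uv: "u + 1 < v" using i by auto
  define ftheta where "ftheta = (\<lambda>i (\<theta> :: nat \<Rightarrow> real). \<theta>(i := T (i, i) * \<theta> (i - 1) - T (i - 1, i) * T (i, i - 1) * \<theta> (i - 2)))"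
  define fphi where "fphi = (\<lambda>i (\<phi> :: nat \<Rightarrow> real). \<phi>(i := T (i, i) * \<phi> (i + 1) - T (i, i + 1) * T (i + 1, i) * \<phi> (i + 2)))"
  define \<theta> where "\<theta> = fold ftheta [u + 2..<v] (fresh(u := 1, u + 1 := T (u + 1, u + 1)))"
  define \<phi> where "\<phi> = fold fphi (rev [u + 1..<v - 1]) (fresh(v := 1, v - 1 := T (v - 1, v - 1)))"
  have entry: "val (tridiagonal_inverse_diagonal T u v) i = \<theta> (i - 1) * \<phi> (i + 1) / \<theta> (v - 1)"
    using i unfolding tridiagonal_inverse_diagonal_def \<theta>_def \<phi>_def ftheta_def fphi_def
    by (simp add: fold_update)
  have \<theta>: "\<forall>i. u \<le> i \<and> i < v \<longrightarrow> \<theta> i = cycle_trees c u i"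
    unfolding \<theta>_def
  proof (rule fold_upt_invariant[where I = "\<lambda>m \<theta>. \<forall>i. u \<le> i \<and> i < m \<longrightarrow> \<theta> i = cycle_trees c u i"])
    have "T (u + 1, u + 1) = cycle_trees c u (u + 1)"
      using T[of "u + 1" "u + 1"] uv by (simp add: tridiagonal_def cycle_trees_Suc)
    then show "\<forall>i. u \<le> i \<and> i < u + 2 \<longrightarrow> (fresh(u := 1, u + 1 := T (u + 1, u + 1))) i = cycle_trees c u i"
      by (auto simp: less_Suc_eq)
  next
    fix m and \<theta> :: "nat \<Rightarrow> real"
    assume m: "u + 2 \<le> m" "m < v" and \<theta>: "\<forall>i. u \<le> i \<and> i < m \<longrightarrow> \<theta> i = cycle_trees c u i"
    define b where "b = m - 2"
    have b: "m = Suc (Suc b)" "u \<le> b"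
      using m(1) by (auto simp: b_def)
    have "ftheta m \<theta> m = cycle_trees c u m"
      using m \<theta> b cycle_trees_Suc_Suc[of u b c]
      by (simp add: ftheta_def T tridiagonal_def)
    then show "\<forall>i. u \<le> i \<and> i < Suc m \<longrightarrow> ftheta m \<theta> i = cycle_trees c u i"
      using \<theta> by (auto simp: ftheta_def less_Suc_eq)
  qed (use uv in auto)
  have \<phi>: "\<forall>i. u + 1 \<le> i \<and> i \<le> v \<longrightarrow> \<phi> i = cycle_trees c (i - 1) (v - 1)"
    unfolding \<phi>_def
  proof (rule fold_rev_upt_invariant[where I = "\<lambda>m \<phi>. \<forall>i. m \<le> i \<and> i \<le> v \<longrightarrow> \<phi> i = cycle_trees c (i - 1) (v - 1)"])
    have "T (v - 1, v - 1) = cycle_trees c (v - 2) (v - 1)"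
      using T[of "v - 1" "v - 1"] cycle_trees_Suc[of "v - 2" "v - 2" c] uv
      by (simp add: tridiagonal_def numeral_2_eq_2 Suc_diff_Suc)
    then show "\<forall>i. v - 1 \<le> i \<and> i \<le> v \<longrightarrow> (fresh(v := 1, v - 1 := T (v - 1, v - 1))) i = cycle_trees c (i - 1) (v - 1)"
      using uv by (auto simp: numeral_2_eq_2)
  next
    fix m and \<phi> :: "nat \<Rightarrow> real"
    assume m: "u + 1 \<le> m" "m < v - 1" and \<phi>: "\<forall>i. Suc m \<le> i \<and> i \<le> v \<longrightarrow> \<phi> i = cycle_trees c (i - 1) (v - 1)"
    obtain a where a: "m = Suc a" "u \<le> a"
      using m(1) by (cases m) auto
    have "fphi m \<phi> m = cycle_trees c (m - 1) (v - 1)"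
      using m \<phi> a cycle_trees_pred_pred[of a "v - 1" c]
      by (simp add: fphi_def T tridiagonal_def)
    moreover have "fphi m \<phi> i = \<phi> i" if "i \<noteq> m" for i
      using that by (simp add: fphi_def)
    ultimately show "\<forall>i. m \<le> i \<and> i \<le> v \<longrightarrow> fphi m \<phi> i = cycle_trees c (i - 1) (v - 1)"
      using \<phi> by (metis le_antisym not_less_eq_eq)
  qed (use uv in auto)
  have "\<theta> (i - 1) = cycle_trees c u (i - 1)" "\<theta> (v - 1) = cycle_trees c u (v - 1)"
    using \<theta>[rule_format, of "i - 1"] \<theta>[rule_format, of "v - 1"] i unfolding greaterThanLessThan_iff by linarith+
  moreover have "\<phi> (i + 1) = cycle_trees c i (v - 1)"
    using \<phi>[rule_format, of "i + 1"] i by simp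
  ultimately show ?thesis
    by (simp only: entry)
qed

lemma val_edge_weight:
  assumes T: "\<And>i j. i \<in> {u<..<v} \<Longrightarrow> j \<in> {u<..<v} \<Longrightarrow> T (i, j) = tridiagonal c i j"
  shows "val (edge_weight T u v) = segment_variance c u v"
proof (cases "u + 1 = v")
  case True
  then show ?thesis by (simp add: edge_weight_def segment_variance_def)
next
  case False
  then have "val (edge_weight T u v) = (\<Sum>i = u+1..<v. val (tridiagonal_inverse_diagonal T u v) i) / 2"
    by (simp add: edge_weight_def fold_add interv_sum_list_conv_sum_set_nat)
  also have "\<dots> = segment_variance c u v"
    using val_tridiagonal_inverse_diagonal[OF T]
    by (simp add: segment_variance_def)
  finally show ?thesis .
qed

text \<open>Correctness rests on the set of in-neighbours, the operation count of the Bellman-Ford algorithm on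
  the length of the list.\<close>

lemma val_construct_digraph:
  assumes "1 \<le> n" "v \<le> n + 1"
  shows "val (construct_digraph n L) v
    = map (\<lambda>u. (u, val (edge_weight L u v))) (rev [if v = n + 1 then 1 else 0..<v])"
proof -
  define w where "w u v = val (edge_weight L u v)" for u v
  define add where "add u v G = G(v := (u, w u v) # G v)" for u v and G :: digraph
  \<comment> \<open>At every stage the list of node \<open>v\<close> holds the in-neighbours below \<open>b v\<close>, latest first. The target
    has no edge from \<open>0\<close>, so its list starts at \<open>1\<close>.\<close>
  define filled where "filled b G \<longleftrightarrow> (\<forall>v \<le> n + 1. G v = map (\<lambda>u. (u, w u v)) (rev [if v = n + 1 then 1 else 0..<b v]))"
    for b :: "nat \<Rightarrow> nat" and G :: digraph
  have filled_add: "filled (b(v := Suc u)) (add u v G)"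
    if "filled b G" "b v = u" "u > 0 \<or> v \<noteq> n + 1" for b u v G
    using that by (auto simp: filled_def add_def)
  \<comment> \<open>For the target, \<open>b v = 0\<close> and \<open>b v = 1\<close> describe the same empty list.\<close>
  have filled_cong: "filled b' G" if "filled b G" "\<And>v. v \<le> n + 1 \<Longrightarrow> b v = b' v \<or> v = n + 1 \<and> b v \<le> 1 \<and> b' v \<le> 1" for b b' G
  proof -
    have "[if v = n + 1 then 1 else 0..<b v] = [if v = n + 1 then 1 else 0..<b' v]" if "v \<le> n + 1" for v
      using \<open>\<And>v. v \<le> n + 1 \<Longrightarrow> b v = b' v \<or> v = n + 1 \<and> b v \<le> 1 \<and> b' v \<le> 1\<close>[OF that] by (auto simp del: upt_Suc)
    then show ?thesis
      using \<open>filled b G\<close> by (simp add: filled_def del: upt_Suc)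
  qed
  define G0 :: digraph where "G0 = fold (\<lambda>v G. G(v := [])) [0..<n + 2] fresh"
  define G1 where "G1 = fold (add 0) [1..<n + 1] G0"
  define G2 where "G2 = fold (\<lambda>v. fold (\<lambda>u. add u v) [1..<v]) [1..<n + 1] G1"
  define G3 where "G3 = fold (\<lambda>v. add v (n + 1)) [1..<n + 1] G2"
  have val: "val (construct_digraph n L) = G3"
    unfolding construct_digraph_def G3_def G2_def G1_def G0_def add_def add_edge_def w_def
    by (simp del: upt_Suc)
  have 0: "filled (\<lambda>v. 0) G0"
    by (simp add: filled_def G0_def fold_update del: upt_Suc)
  have 1: "filled (\<lambda>v. if 1 \<le> v \<and> v < n + 1 then 1 else 0) G1"
    unfolding G1_def
  proof (rule fold_upt_invariant[where I = "\<lambda>m. filled (\<lambda>v. if 1 \<le> v \<and> v < m then 1 else 0)"])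
    fix m G assume "1 \<le> m" "m < n + 1" "filled (\<lambda>v. if 1 \<le> v \<and> v < m then 1 else 0) G"
    then show "filled (\<lambda>v. if 1 \<le> v \<and> v < Suc m then 1 else 0) (add 0 m G)"
      by (intro filled_cong[OF filled_add[of "\<lambda>v. if 1 \<le> v \<and> v < m then 1 else 0"]]) (auto simp: less_Suc_eq)
  next
    show "filled (\<lambda>v. if 1 \<le> v \<and> v < 1 then 1 else 0) G0"
      using 0 by (rule filled_cong) auto
  qed auto
  have 2: "filled (\<lambda>v. if v = n + 1 then 0 else if v < n + 1 then v else 1) G2"
    unfolding G2_def
  proof (rule fold_upt_invariant[where I = "\<lambda>m. filled (\<lambda>v. if v = n + 1 then 0 else if v < m then v else 1)"])
    show "filled (\<lambda>v. if v = n + 1 then 0 else if v < 1 then v else 1) G1"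
      using 1 by (rule filled_cong) auto
  next
    fix m G assume m: "1 \<le> m" "m < n + 1" and G: "filled (\<lambda>v. if v = n + 1 then 0 else if v < m then v else 1) G"
    let ?b = "\<lambda>v. if v = n + 1 then 0 else if v < m then v else 1"
    have "filled (?b(m := m)) (fold (\<lambda>u. add u m) [1..<m] G)"
    proof (rule fold_upt_invariant[where I = "\<lambda>a. filled (?b(m := a))"])
      show "filled (?b(m := 1)) G"
        using G by (rule filled_cong) auto
    next
      fix a H assume "1 \<le> a" "a < m" "filled (?b(m := a)) H"
      then show "filled (?b(m := Suc a)) (add a m H)"
        using filled_add[of "?b(m := a)" H m a] by (simp add: fun_upd_upd)
    qed (use m in auto)
    then show "filled (\<lambda>v. if v = n + 1 then 0 else if v < Suc m then v else 1) (fold (\<lambda>u. add u m) [1..<m] G)"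
      using m by (elim filled_cong) auto
  qed (use assms in auto)
  have 3: "filled (\<lambda>v. if v = n + 1 then n + 1 else v) G3"
    unfolding G3_def
  proof (rule fold_upt_invariant[where I = "\<lambda>m. filled (\<lambda>v. if v = n + 1 then m else v)"])
    show "filled (\<lambda>v. if v = n + 1 then 1 else v) G2"
      using 2 by (rule filled_cong) auto
  next
    fix m G assume "1 \<le> m" "m < n + 1" "filled (\<lambda>v. if v = n + 1 then m else v) G"
    then show "filled (\<lambda>v. if v = n + 1 then Suc m else v) (add m (n + 1) G)"
      by (intro filled_cong[OF filled_add[of "\<lambda>v. if v = n + 1 then m else v"]]) auto
  qed (use assms in auto)
  show ?thesis
    using 3 assms(2) unfolding val filled_def w_def by auto
qed

section \<open>Correctness of the modified Bellman-Ford algorithm\<close>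

text \<open>In \<open>walk G s m v P x\<close>, \<open>P\<close> is the node list and \<open>x\<close> the weight of a walk with \<open>m\<close> edges. Walks grow at their
  end because each round of the algorithm appends an edge.\<close>

inductive walk :: "digraph \<Rightarrow> nat \<Rightarrow> nat \<Rightarrow> nat \<Rightarrow> nat list \<Rightarrow> real \<Rightarrow> bool" for G s where
  start: "walk G s 0 s [s] 0"
| extend: "walk G s m u P x \<Longrightarrow> (u, w) \<in> set (G v) \<Longrightarrow> walk G s (Suc m) v (P @ [v]) (x + w)"

text \<open>Bellman's equation together with the attainment of the minimum by the recorded predecessor. Which
  minimiser is recorded remains open, so the statements below hold for every way of breaking ties.\<close>

definition is_min_step ::
    "digraph \<Rightarrow> (nat \<times> nat \<Rightarrow> ereal) \<Rightarrow> (nat \<times> nat \<Rightarrow> nat) \<Rightarrow> nat \<Rightarrow> nat \<Rightarrow> bool" where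
  "is_min_step G d \<pi> m v \<longleftrightarrow>
    (if G v = [] then d (m, v) = \<infinity>
     else (\<exists>w. (\<pi> (m, v), w) \<in> set (G v) \<and> d (m, v) = d (m - 1, \<pi> (m, v)) + ereal w) \<and>
       (\<forall>(u, w) \<in> set (G v). d (m, v) \<le> d (m - 1, u) + ereal w))"

definition bellman_table ::
    "digraph \<Rightarrow> nat \<Rightarrow> nat \<Rightarrow> nat \<Rightarrow> (nat \<times> nat \<Rightarrow> ereal) \<Rightarrow> (nat \<times> nat \<Rightarrow> nat) \<Rightarrow> bool" where
  "bellman_table G N s H d \<pi> \<longleftrightarrow>
    (\<forall>v < N. d (0, v) = (if v = s then 0 else \<infinity>)) \<and> (\<forall>m \<in> {1..H}. \<forall>v < N. is_min_step G d \<pi> m v)"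

lemma val_candidate [simp]: "val (candidate d m u w) = d (m - 1, u) + ereal w"
  by (simp add: candidate_def)

text \<open>Each comparison keeps the better of the current minimum and the new candidate; when they are equal
  either may survive.\<close>

lemma val_relax:
  assumes "val (relax tie m v es (d, \<pi>)) = (d', \<pi>')" "es \<noteq> []"
  obtains u w where "(u, w) \<in> set es"
    "d' = d((m, v) := d (m - 1, u) + ereal w)" "\<pi>' = \<pi>((m, v) := u)"
    "\<forall>(u', w') \<in> set es. d (m - 1, u) + ereal w \<le> d (m - 1, u') + ereal w'"
proof -
  define f where "f e s = (let y = d (m - 1, fst e) + ereal (snd e) in
    if (if tie (fst e) (snd s) then y \<le> fst s else y < fst s) then (y, fst e) else s)" for e s
  obtain u0 w0 es' where es: "es = (u0, w0) # es'"
    using assms(2) by (cases es) auto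
  define xp where "xp = fold f es' (d (m - 1, u0) + ereal w0, u0)"
  have best: "(\<exists>(u, w) \<in> set ((u0, w0) # xs). fold f xs (d (m - 1, u0) + ereal w0, u0) = (d (m - 1, u) + ereal w, u)) \<and>
    (\<forall>(u, w) \<in> set ((u0, w0) # xs). fst (fold f xs (d (m - 1, u0) + ereal w0, u0)) \<le> d (m - 1, u) + ereal w)" for xs
  proof (induction xs rule: rev_induct)
    case (snoc e xs)
    obtain u w where e: "e = (u, w)" by force
    let ?p = "fold f xs (d (m - 1, u0) + ereal w0, u0)" and ?y = "d (m - 1, u) + ereal w"
    have "f e ?p = (?y, u) \<and> ?y \<le> fst ?p \<or> f e ?p = ?p \<and> fst ?p \<le> ?y"
      by (auto simp: f_def e Let_def split: prod.splits)
    then show ?case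
    proof (elim disjE conjE)
      assume new: "f e ?p = (?y, u)" and le: "?y \<le> fst ?p"
      have "?y \<le> d (m - 1, u') + ereal w'" if "(u', w') \<in> set ((u0, w0) # xs)" for u' w'
        using snoc that by (blast intro: order_trans[OF le])
      then show ?thesis using new by (auto simp: e)
    next
      assume "f e ?p = ?p" "fst ?p \<le> ?y"
      then show ?thesis using snoc by (auto simp: e)
    qed
  qed auto
  have "val (relax tie m v es (d, \<pi>)) = (d((m, v) := fst xp), \<pi>((m, v) := snd xp))"
    unfolding relax_def es xp_def f_def
    by (simp add: case_prod_beta Let_def cong: if_cong)
  then have "d' = d((m, v) := fst xp)" "\<pi>' = \<pi>((m, v) := snd xp)"
    using assms(1) by auto
  moreover obtain u w where "(u, w) \<in> set es" "xp = (d (m - 1, u) + ereal w, u)"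
    using best[of es'] by (auto simp: es xp_def)
  moreover have "\<forall>(u', w') \<in> set es. fst xp \<le> d (m - 1, u') + ereal w'"
    using best[of es'] unfolding es xp_def by simp
  ultimately show thesis
    by (intro that[of u w]) auto
qed

definition relax_node ::
    "(nat \<Rightarrow> nat \<Rightarrow> nat \<Rightarrow> nat \<Rightarrow> bool) \<Rightarrow> digraph \<Rightarrow> nat \<Rightarrow> nat
     \<Rightarrow> (nat \<times> nat \<Rightarrow> ereal) \<times> (nat \<times> nat \<Rightarrow> nat) \<Rightarrow> (nat \<times> nat \<Rightarrow> ereal) \<times> (nat \<times> nat \<Rightarrow> nat)" where
  "relax_node tie G m v s = val (relax (tie m v) m v (G v) s)"

lemma relax_node_step:
  assumes "relax_node tie G m v (d, \<pi>) = (d', \<pi>')" "1 \<le> m" "d (m, v) = \<infinity>"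
  shows "is_min_step G d' \<pi>' m v"
    and "\<And>p. p \<noteq> (m, v) \<Longrightarrow> d' p = d p \<and> \<pi>' p = \<pi> p"
proof -
  have "is_min_step G d' \<pi>' m v \<and> (\<forall>p. p \<noteq> (m, v) \<longrightarrow> d' p = d p \<and> \<pi>' p = \<pi> p)"
  proof (cases "G v = []")
    case True
    then show ?thesis
      using assms by (auto simp: relax_node_def relax_def is_min_step_def)
  next
    case False
    have "m - 1 \<noteq> m" using assms(2) by simp
    then have d'_prev: "(d((m, v) := x)) (m - 1, u) = d (m - 1, u)" for x u by simp
    obtain u w where u: "(u, w) \<in> set (G v)" "d' = d((m, v) := d (m - 1, u) + ereal w)" "\<pi>' = \<pi>((m, v) := u)"
      and min: "\<forall>(u', w') \<in> set (G v). d (m - 1, u) + ereal w \<le> d (m - 1, u') + ereal w'"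
      using val_relax[OF assms(1)[unfolded relax_node_def] False] .
    have "is_min_step G d' \<pi>' m v"
      unfolding is_min_step_def u(2,3) d'_prev using False u(1) min by auto
    then show ?thesis
      by (simp add: u(2,3))
  qed
  then show "is_min_step G d' \<pi>' m v" "\<And>p. p \<noteq> (m, v) \<Longrightarrow> d' p = d p \<and> \<pi>' p = \<pi> p"
    by auto
qed

lemma is_min_step_cong:
  assumes "is_min_step G d \<pi> m v" "d' (m, v) = d (m, v)" "\<pi>' (m, v) = \<pi> (m, v)"
    and "\<And>u w. (u, w) \<in> set (G v) \<Longrightarrow> d' (m - 1, u) = d (m - 1, u)"
  shows "is_min_step G d' \<pi>' m v"
  using assms unfolding is_min_step_def by (fastforce split: if_splits)

text \<open>Round \<open>m\<close> writes only row \<open>m\<close> and reads only row \<open>m - 1\<close>, which is complete by then. Hence Bellman's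
  equations, once established, are never destroyed.\<close>

lemma bellman_table_relax:
  assumes d0: "\<And>m v. m \<le> H \<Longrightarrow> v < N \<Longrightarrow> d0 (m, v) = (if (m, v) = (0, s) then 0 else \<infinity>)"
    and "fold (\<lambda>m. fold (relax_node tie G m) [0..<N]) [1..<H + 1] (d0, \<pi>0) = (d, \<pi>)"
  shows "bellman_table G N s H d \<pi>"
proof -
  define filled where "filled m v s \<longleftrightarrow>
    (\<forall>v' < N. fst s (0, v') = d0 (0, v')) \<and>
    (\<forall>m' v'. m' \<noteq> 0 \<and> m' \<le> H \<and> v' < N \<and> (m' < m \<or> m' = m \<and> v' < v) \<longrightarrow> is_min_step G (fst s) (snd s) m' v') \<and>
    (\<forall>m' v'. m' \<noteq> 0 \<and> m' \<le> H \<and> v' < N \<and> \<not> (m' < m \<or> m' = m \<and> v' < v) \<longrightarrow> fst s (m', v') = \<infinity>)" for m v s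
  have "filled (H + 1) 0 (fold (\<lambda>m. fold (relax_node tie G m) [0..<N]) [1..<H + 1] (d0, \<pi>0))"
  proof (rule fold_upt_invariant[where I = "\<lambda>m. filled m 0"])
    show "filled 1 0 (d0, \<pi>0)"
      using d0 by (auto simp: filled_def)
  next
    fix m s assume m: "1 \<le> m" "m < H + 1" "filled m 0 s"
    have "filled m N (fold (relax_node tie G m) [0..<N] s)"
    proof (rule fold_upt_invariant[where I = "filled m"])
      fix v s assume v: "0 \<le> v" "v < N" and filled: "filled m v s"
      obtain d \<pi> d' \<pi>' where s: "s = (d, \<pi>)" and s': "relax_node tie G m v s = (d', \<pi>')"
        by (metis surj_pair)
      have "d (m, v) = \<infinity>"
        using filled m v by (simp add: filled_def s)
      note step = relax_node_step[OF s'[unfolded s] m(1) this]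
      have unchanged: "d' (m', v') = d (m', v')" "\<pi>' (m', v') = \<pi> (m', v')" if "m' \<noteq> m \<or> v' \<noteq> v" for m' v'
        using step(2)[of "(m', v')"] that by auto
      have old: "is_min_step G d' \<pi>' m' v'"
        if "m' \<le> H" "v' < N" "m' \<noteq> 0" "m' < m \<or> m' = m \<and> v' < v" for m' v'
      proof (rule is_min_step_cong)
        show "is_min_step G d \<pi> m' v'"
          using filled that by (simp add: filled_def s)
        show "d' (m' - 1, u) = d (m' - 1, u)" for u
          using that by (intro unchanged) auto
      qed (use that in \<open>auto intro!: unchanged\<close>)
      have new: "is_min_step G d' \<pi>' m' v'"
        if "m' \<le> H" "v' < N" "m' \<noteq> 0" "m' < m \<or> m' = m \<and> v' < Suc v" for m' v'
        using old[OF that(1-3)] step(1) that(4) by (auto simp: less_Suc_eq)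
      have "d' (m', v') = \<infinity>"
        if "m' \<le> H" "v' < N" "m' \<noteq> 0" "\<not> (m' < m \<or> m' = m \<and> v' < Suc v)" for m' v'
        using filled that unchanged(1)[of m' v'] by (auto simp: filled_def s)
      moreover have "d' (0, v') = d0 (0, v')" if "v' < N" for v'
        using filled that unchanged(1)[of 0 v'] m(1) by (auto simp: filled_def s)
      ultimately show "filled m (Suc v) (relax_node tie G m v s)"
        using new unfolding filled_def s' by auto
    qed (use m in auto)
    then show "filled (Suc m) 0 (fold (relax_node tie G m) [0..<N] s)"
      unfolding filled_def by (auto simp: less_Suc_eq)
  qed auto
  then show ?thesis
    unfolding assms(2) using d0 by (auto simp: filled_def bellman_table_def)
qed

lemma bellman_table_lower_bound:
  assumes table: "bellman_table G N s H d \<pi>" and nodes: "\<And>u v w. v < N \<Longrightarrow> (u, w) \<in> set (G v) \<Longrightarrow> u < N"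
    and "walk G s m v P x" "m \<le> H" "v < N"
  shows "d (m, v) \<le> ereal x"
  using assms(3-)
proof (induction rule: walk.induct)
  case start
  then show ?case using table by (auto simp: bellman_table_def)
next
  case (extend m u P x w v)
  then have "d (m, u) \<le> ereal x" using nodes by auto
  then have "d (m, u) + ereal w \<le> ereal (x + w)"
    by (metis add_right_mono plus_ereal.simps(1))
  moreover have "is_min_step G d \<pi> (Suc m) v"
    using table extend.prems by (auto simp: bellman_table_def)
  then have "d (Suc m, v) \<le> d (m, u) + ereal w"
    using extend.hyps(2) by (force simp: is_min_step_def split: if_splits)
  ultimately show ?case by (metis order_trans)
qed

text \<open>The value \<open>\<infinity>\<close> must be excluded because predecessors of unreachable nodes lead nowhere. Along the
  predecessors of a finite entry all entries are finite.\<close>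

lemma bellman_table_retrieve:
  assumes table: "bellman_table G N s H d \<pi>" and nodes: "\<And>u v w. v < N \<Longrightarrow> (u, w) \<in> set (G v) \<Longrightarrow> u < N"
    and "m \<le> H" "v < N" "d (m, v) \<noteq> \<infinity>"
  shows "\<exists>P x. walk G s m v P x \<and> d (m, v) = ereal x \<and> (\<forall>Q. val (retrieve \<pi> m v Q) = P @ Q)"
  using assms(3-)
proof (induction m arbitrary: v)
  case 0
  then have "v = s" "d (0, v) = 0"
    using table by (auto simp: bellman_table_def split: if_splits)
  then show ?case
    using walk.start[of G s] by (auto simp: zero_ereal_def intro!: exI[of _ "[s]"])
next
  case (Suc m)
  have "is_min_step G d \<pi> (Suc m) v"
    using table Suc.prems by (auto simp: bellman_table_def)
  then obtain w where w: "(\<pi> (Suc m, v), w) \<in> set (G v)" "d (Suc m, v) = d (m, \<pi> (Suc m, v)) + ereal w"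
    using Suc.prems by (auto simp: is_min_step_def split: if_splits)
  have "d (m, \<pi> (Suc m, v)) \<noteq> \<infinity>"
    using w(2) Suc.prems by auto
  then obtain P x where P: "walk G s m (\<pi> (Suc m, v)) P x" "d (m, \<pi> (Suc m, v)) = ereal x"
      "\<forall>Q. val (retrieve \<pi> m (\<pi> (Suc m, v)) Q) = P @ Q"
    using Suc.IH[of "\<pi> (Suc m, v)"] nodes[OF _ w(1)] Suc.prems by auto
  show ?case
    using walk.extend[OF P(1) w(1)] P(2,3) w(2) by fastforce
qed

text \<open>The number of edges that the last loop of \<open>bellman_ford\<close> settles on.\<close>

definition best_length ::
    "(nat \<Rightarrow> nat \<Rightarrow> bool) \<Rightarrow> (nat \<times> nat \<Rightarrow> ereal) \<Rightarrow> nat \<Rightarrow> nat \<Rightarrow> nat" where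
  "best_length tie_end d t H = fold (\<lambda>m h. if (if tie_end m h then d (m, t) \<le> d (h, t) else d (m, t) < d (h, t)) then m else h)
    [2..<H + 1] 1"

lemma best_length:
  assumes "1 \<le> H"
  shows "best_length tie_end d t H \<in> {1..H}"
    and "m \<in> {1..H} \<Longrightarrow> d (best_length tie_end d t H, t) \<le> d (m, t)"
proof -
  have "best_length tie_end d t H \<in> {1..<H + 1} \<and> (\<forall>m \<in> {1..<H + 1}. d (best_length tie_end d t H, t) \<le> d (m, t))"
    unfolding best_length_def
  proof (rule fold_upt_invariant[where I = "\<lambda>a h. h \<in> {1..<a} \<and> (\<forall>m \<in> {1..<a}. d (h, t) \<le> d (m, t))"])
    fix a h assume h: "h \<in> {1..<a} \<and> (\<forall>m \<in> {1..<a}. d (h, t) \<le> d (m, t))"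
    let ?new = "if tie_end a h then d (a, t) \<le> d (h, t) else d (a, t) < d (h, t)"
    show "(if ?new then a else h) \<in> {1..<Suc a} \<and> (\<forall>m \<in> {1..<Suc a}. d (if ?new then a else h, t) \<le> d (m, t))"
    proof (cases ?new)
      case True
      then have "d (a, t) \<le> d (h, t)" by (auto split: if_splits)
      then have "\<forall>m \<in> {1..<a}. d (a, t) \<le> d (m, t)"
        using h order_trans by blast
      then show ?thesis using h True by (auto simp: less_Suc_eq)
    next
      case False
      then have "d (h, t) \<le> d (a, t)" by (auto split: if_splits)
      then show ?thesis using h False by (auto simp: less_Suc_eq)
    qed
  qed (use assms in \<open>auto simp: numeral_2_eq_2 less_Suc_eq\<close>)
  then show "best_length tie_end d t H \<in> {1..H}"
    "m \<in> {1..H} \<Longrightarrow> d (best_length tie_end d t H, t) \<le> d (m, t)"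
    by auto
qed

lemma val_bellman_ford:
  obtains d \<pi> where
    "bellman_table G N s H d \<pi>"
    "val (bellman_ford tie tie_end G N s t H) =
      (val (retrieve \<pi> (best_length tie_end d t H) t []), d (best_length tie_end d t H, t))"
proof -
  define d0 :: "nat \<times> nat \<Rightarrow> ereal" where
    "d0 = (\<lambda>p. if p \<in> set [0..<H + 1] \<times> set [0..<N] then \<infinity> else fresh p)((0, s) := 0)"
  obtain d \<pi> where d: "fold (\<lambda>m. fold (relax_node tie G m) [0..<N]) [1..<H + 1] (d0, fresh) = (d, \<pi>)"
    by force
  show thesis
  proof (rule that)
    show "bellman_table G N s H d \<pi>"
      by (rule bellman_table_relax[OF _ d]) (auto simp: d0_def)
    have body: "val (case x of (d, \<pi>) \<Rightarrow> bind_tm (get_tm G v) (\<lambda>es. relax (tie m v) m v es (d, \<pi>)))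
        = relax_node tie G m v x" for x m v
      by (cases x) (simp add: relax_node_def)
    show "val (bellman_ford tie tie_end G N s t H) =
        (val (retrieve \<pi> (best_length tie_end d t H) t []), d (best_length tie_end d t H, t))"
      using d unfolding bellman_ford_def val_simps val_foreach body fold_fold_update d0_def best_length_def
      by (simp del: upt_Suc)
  qed
qed

text \<open>Some walk must reach \<open>t\<close>, since otherwise all entries at \<open>t\<close> are \<open>\<infinity>\<close> and there is nothing to
  retrieve.\<close>

lemma bellman_ford_correct:
  assumes "1 \<le> H" "t < N"
    and nodes: "\<And>u v w. v < N \<Longrightarrow> (u, w) \<in> set (G v) \<Longrightarrow> u < N"
    and reachable: "walk G s m0 t P0 x0" "m0 \<in> {1..H}"
  obtains P m x where "val (bellman_ford tie tie_end G N s t H) = (P, ereal x)"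
    "walk G s m t P x" "m \<in> {1..H}"
    "\<And>m' P' x'. walk G s m' t P' x' \<Longrightarrow> m' \<in> {1..H} \<Longrightarrow> x \<le> x'"
proof -
  obtain d \<pi> where table: "bellman_table G N s H d \<pi>" and
    val: "val (bellman_ford tie tie_end G N s t H) =
      (val (retrieve \<pi> (best_length tie_end d t H) t []), d (best_length tie_end d t H, t))"
    by (rule val_bellman_ford)
  define h where "h = best_length tie_end d t H"
  have h: "h \<in> {1..H}" "\<And>m. m \<in> {1..H} \<Longrightarrow> d (h, t) \<le> d (m, t)"
    using best_length[OF assms(1)] by (auto simp: h_def)
  have bound: "d (h, t) \<le> ereal x" if "walk G s m t P x" "m \<in> {1..H}" for m P x
  proof -
    have "d (m, t) \<le> ereal x"
      by (rule bellman_table_lower_bound[OF table _ that(1)]) (use nodes that(2) assms(2) in auto)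
    with h(2)[OF that(2)] show ?thesis by (rule order_trans)
  qed
  have "d (h, t) \<noteq> \<infinity>"
    using bound[OF reachable] by auto
  then obtain P x where P: "walk G s h t P x" "d (h, t) = ereal x" "val (retrieve \<pi> h t []) = P"
    using bellman_table_retrieve[where G = G and m = h and v = t, OF table] nodes h(1) assms(2) by fastforce
  show thesis
  proof (rule that)
    show "val (bellman_ford tie tie_end G N s t H) = (P, ereal x)"
      using val P by (simp add: h_def)
    show "walk G s h t P x" "h \<in> {1..H}" by fact+
    show "x \<le> x'" if "walk G s m' t P' x'" "m' \<in> {1..H}" for m' P' x'
      using bound[OF that] P(2) by simp
  qed
qed

section \<open>Walks and leader sets\<close>

text \<open>The pair \<open>(0, n + 1)\<close> is excluded because a walk along it would visit no leader.\<close>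

definition path_digraph :: "nat \<Rightarrow> (nat \<Rightarrow> nat \<Rightarrow> real) \<Rightarrow> digraph \<Rightarrow> bool" where
  "path_digraph n w G \<longleftrightarrow> (\<forall>v \<le> n + 1. set (G v) = {(u, w u v) | u. u < v \<and> \<not> (u = 0 \<and> v = n + 1)})"

text \<open>Soundness of the reduction: the inner nodes of a walk from \<open>0\<close> to \<open>n + 1\<close> form a nonempty leader set.\<close>

lemma walk_increasing:
  assumes G: "path_digraph n w G"
    and "walk G 0 m v P x" "v \<le> n + 1"
  shows "sorted_wrt (<) P \<and> P \<noteq> [] \<and> hd P = 0 \<and> last P = v \<and> length P = m + 1 \<and> set P \<subseteq> {0..v} \<and>
    x = path_weight w P \<and> (v = n + 1 \<longrightarrow> set P - {0, n + 1} \<noteq> {})"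
  using assms(2-)
proof (induction rule: walk.induct)
  case (extend m u P x y v)
  then have u: "u < v" "y = w u v" "\<not> (u = 0 \<and> v = n + 1)"
    using G by (auto simp: path_digraph_def)
  note IH = extend.IH[OF order_trans[OF less_imp_le[OF u(1)] extend.prems]]
  have P: "P = butlast P @ [u]"
    using IH by (metis append_butlast_last_id)
  have "path_weight w (P @ [v]) = path_weight w P + w u v"
    using path_weight_snoc[of w "butlast P" u v] P by (metis append.assoc append_Cons append_Nil)
  moreover have "u \<in> set P" using P by (metis in_set_conv_decomp)
  ultimately show ?case
    using IH u by (auto simp: sorted_wrt_append subset_iff le_less_trans)
qed auto

text \<open>Completeness of the reduction: every leader set, listed between the sentinels, is a walk.\<close>

lemma increasing_walk:
  assumes G: "path_digraph n w G"
    and "sorted_wrt (<) P" "P \<noteq> []" "hd P = 0" "last P \<le> n + 1" "P \<noteq> [0, n + 1]"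
  shows "walk G 0 (length P - 1) (last P) P (path_weight w P)"
  using assms(2-)
proof (induction P rule: rev_induct)
  case (snoc v Q)
  show ?case
  proof (cases Q rule: rev_cases)
    case Nil
    then show ?thesis
      using snoc.prems walk.start[of G 0] by simp
  next
    case (snoc Q' u)
    have uv: "u < v"
      using snoc.prems snoc by (auto simp: sorted_wrt_append)
    have "hd Q = 0"
      using snoc.prems(3) snoc by (cases Q') auto
    have "walk G 0 (length Q - 1) u Q (path_weight w Q)"
      using snoc.IH snoc.prems snoc uv \<open>hd Q = 0\<close> by (auto simp: sorted_wrt_append)
    moreover have "\<not> (u = 0 \<and> v = n + 1)"
    proof
      assume "u = 0 \<and> v = n + 1"
      moreover from this have "Q' = []"
        using snoc.prems(1) snoc by (cases Q') (auto simp: sorted_wrt_append)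
      ultimately show False
        using snoc.prems(5) snoc by simp
    qed
    then have "(u, w u v) \<in> set (G v)"
      using G uv snoc.prems(4) by (auto simp: path_digraph_def)
    ultimately have "walk G 0 (Suc (length Q - 1)) v (Q @ [v]) (path_weight w Q + w u v)"
      by (rule walk.extend)
    then show ?thesis
      using snoc path_weight_snoc[of w Q' u v] by simp
  qed
qed auto

lemma path_digraph_construct_digraph:
  assumes "1 \<le> n"
  shows "path_digraph n (segment_variance (conductance n \<nu>)) (val (construct_digraph n (val (form_laplacian n \<nu>))))"
proof -
  have "val (edge_weight (val (form_laplacian n \<nu>)) u v) = segment_variance (conductance n \<nu>) u v"
    if "v \<le> n + 1" for u v
    by (rule val_edge_weight, rule val_form_laplacian) (use that assms in auto)
  then show ?thesis
    using assms by (fastforce simp: path_digraph_def val_construct_digraph)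
qed

lemma set_remove_ends: "set (val (remove_ends s t P)) = set P - {s, t}"
proof -
  have "set (fold (\<lambda>v S. if v = s \<or> v = t then S else v # S) P Q) = (set P - {s, t}) \<union> set Q" for Q
    by (induction P arbitrary: Q) auto
  then show ?thesis
    by (simp add: remove_ends_def if_distrib[of val] cong: if_cong)
qed

lemma leader_selection_correct:
  assumes "1 \<le> n" "1 \<le> k" and \<nu>: "noise_weights n \<nu>"
  obtains S where "val (leader_selection tie tie_end n \<nu> k) = (S, ereal (total_variance n \<nu> (set S)))"
    "is_arg_min (total_variance n \<nu>) (leader_set n k) (set S)"
proof -
  define w where "w = segment_variance (conductance n \<nu>)"
  define G where "G = val (construct_digraph n (val (form_laplacian n \<nu>)))"
  have G: "path_digraph n w G"
    unfolding w_def G_def using assms(1) by (rule path_digraph_construct_digraph)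
  have nodes: "u < n + 2" if "v < n + 2" "(u, y) \<in> set (G v)" for u v y
    using that G by (auto simp: path_digraph_def)
  \<comment> \<open>The target is reachable: node \<open>1\<close> alone is a leader set.\<close>
  have "walk G 0 2 (n + 1) [0, 1, n + 1] (path_weight w [0, 1, n + 1])"
    using increasing_walk[OF G, of "[0, 1, n + 1]"] assms(1) by (simp add: numeral_2_eq_2)
  then obtain P m x where P: "val (bellman_ford tie tie_end G (n + 2) 0 (n + 1) (k + 1)) = (P, ereal x)"
    "walk G 0 m (n + 1) P x" "m \<in> {1..k + 1}"
    and min: "\<And>m' P' x'. walk G 0 m' (n + 1) P' x' \<Longrightarrow> m' \<in> {1..k + 1} \<Longrightarrow> x \<le> x'"
    by (rule bellman_ford_correct[where G = G and N = "n + 2" and H = "k + 1" and t = "n + 1" and s = 0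
          and tie = tie and tie_end = tie_end and ?m0.0 = 2, rotated 3]) (use assms nodes in auto)
  have inc: "sorted_wrt (<) P" "P \<noteq> []" "hd P = 0" "last P = n + 1" "length P = m + 1" "set P \<subseteq> {0..n + 1}"
    "x = path_weight w P" "set P - {0, n + 1} \<noteq> {}"
    using walk_increasing[OF G P(2)] by auto
  have x: "x = total_variance n \<nu> (set P - {0, n + 1})"
    using total_variance_eq_path_weight[OF \<nu> inc(1-4,8)] inc(7) by (simp add: w_def)
  have "card (set P - {0, n + 1}) \<le> k"
  proof -
    have "{0, n + 1} \<subseteq> set P"
      using inc(2-4) hd_in_set[of P] last_in_set[of P] by auto
    moreover have "card (set P) = m + 1"
      using inc(1,5) by (simp add: distinct_card strict_sorted_iff)
    ultimately have "card (set P - {0, n + 1}) = m + 1 - 2"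
      by (simp add: card_Diff_subset)
    then show ?thesis using P(3) by auto
  qed
  then have leader: "leader_set n k (set P - {0, n + 1})"
    using inc(6,8) by (auto simp: leader_set_def Suc_le_eq subset_iff le_Suc_eq)
  have best: "x \<le> total_variance n \<nu> T" if T: "leader_set n k T" for T
  proof -
    have T': "T \<subseteq> {1..n}" "T \<noteq> {}" "card T \<le> k" "finite T"
      using T by (auto simp: leader_set_def intro: finite_subset)
    define Q where "Q = 0 # sorted_list_of_set T @ [n + 1]"
    have Q: "sorted_wrt (<) Q" "Q \<noteq> []" "hd Q = 0" "last Q = n + 1" "length Q = card T + 2"
      using T' by (auto simp: Q_def sorted_wrt_append)
    have set_Q: "set Q - {0, n + 1} = T"
      using T' by (auto simp: Q_def)
    then have "Q \<noteq> [0, n + 1]"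
      using T'(2) by auto
    then have "walk G 0 (length Q - 1) (n + 1) Q (path_weight w Q)"
      using increasing_walk[OF G Q(1-3)] Q(4) by simp
    then have "x \<le> path_weight w Q"
      using Q(5) T'(3) by (intro min) auto
    also have "\<dots> = total_variance n \<nu> T"
      using total_variance_eq_path_weight[OF \<nu> Q(1-4)] T'(2) unfolding set_Q by (simp add: w_def)
    finally show ?thesis .
  qed
  show thesis
  proof (rule that)
    show "val (leader_selection tie tie_end n \<nu> k) = (val (remove_ends 0 (n + 1) P),
        ereal (total_variance n \<nu> (set (val (remove_ends 0 (n + 1) P)))))"
      using P(1) x by (simp add: leader_selection_def G_def set_remove_ends)
    show "is_arg_min (total_variance n \<nu>) (leader_set n k) (set (val (remove_ends 0 (n + 1) P)))"
      using leader best unfolding x by (auto simp: set_remove_ends is_arg_min_def not_less)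
  qed
qed

section \<open>Operation counts\<close>

text \<open>These rules bound the cost of a program by recursion over its syntax. Applied to a goal with an
  unknown bound, they compute the bound.\<close>

lemma cost_primitive:
  "cost (return x) \<le> 0" "cost (step x) \<le> 1" "cost (add_tm a b) \<le> 1" "cost (sub_tm r s) \<le> 1"
  "cost (mul_tm r s) \<le> 1" "cost (div_tm r s) \<le> 1" "cost (eq_tm k l) \<le> 1" "cost (better_tm tie y z) \<le> 1"
  "cost (get_tm T i) \<le> 1" "cost (put_tm T i x) \<le> 1" "cost (cons_tm x xs) \<le> 1"
  for a b :: "'b :: plus"
  by (simp_all add: return_def step_def add_tm_def sub_tm_def mul_tm_def div_tm_def
      eq_tm_def better_tm_def get_tm_def put_tm_def cons_tm_def)

text \<open>The continuation is bounded at the value of \<open>p\<close> only, not for all arguments: the length of a loop may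
  depend on a value read before, such as the list of incoming edges of a node.\<close>

lemma cost_bind: "cost p \<le> a \<Longrightarrow> cost (f (val p)) \<le> b \<Longrightarrow> cost (bind_tm p f) \<le> a + b"
  by (simp add: bind_tm_def)

text \<open>The sum instead of the maximum, so that the rule applies when both bounds are still unknown.\<close>

lemma cost_if: "cost p \<le> a \<Longrightarrow> cost q \<le> b \<Longrightarrow> cost (if c then p else q) \<le> a + b"
  by simp

lemma cost_case_prod: "(\<And>y z. cost (f y z) \<le> a) \<Longrightarrow> cost (case p of (y, z) \<Rightarrow> f y z) \<le> a"
  by (cases p) simp

lemma cost_case_prod_apply: "(\<And>y z. cost (f y z s) \<le> a) \<Longrightarrow> cost ((case p of (y, z) \<Rightarrow> f y z) s) \<le> a"
  by (cases p) simp

lemma cost_foreach: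
  assumes "length xs \<le> l" "\<And>x s. x \<in> set xs \<Longrightarrow> cost (body x s) \<le> B"
  shows "cost (foreach xs body s) \<le> 1 + l * (1 + B)"
proof -
  have "cost (foreach xs body s) \<le> 1 + length xs * (1 + B)"
    using assms(2)
  proof (induction xs arbitrary: s)
    case (Cons x xs)
    have "cost (body x s) \<le> B"
      "cost (foreach xs body (val (body x s))) \<le> 1 + length xs * (1 + B)"
      using Cons by auto
    then show ?case by (simp add: bind_tm_def step_def)
  qed (simp add: step_def)
  also have "\<dots> \<le> 1 + l * (1 + B)"
    using assms(1) by (intro add_left_mono mult_right_mono) auto
  finally show ?thesis .
qed

lemmas cost_rules = cost_primitive cost_bind cost_if cost_case_prod cost_case_prod_apply

lemma cost_form_laplacian: "cost (form_laplacian n \<nu>) \<le> 2 + n * 14 + n * n * 2"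
  unfolding form_laplacian_def
  by (rule order_trans, (rule cost_rules cost_foreach[where l = n] | (simp; fail))+)

lemma cost_tridiagonal_inverse_diagonal:
  assumes "v \<le> n + 1"
  shows "cost (tridiagonal_inverse_diagonal T u v) \<le> 10 + n * 28"
  unfolding tridiagonal_inverse_diagonal_def
  by (rule order_trans, (rule cost_rules cost_foreach[where l = n] | (use assms in simp; fail))+)

lemma cost_edge_weight:
  assumes "v \<le> n + 1"
  shows "cost (edge_weight L u v) \<le> 13 + n * 31"
  unfolding edge_weight_def
  by (rule order_trans, (rule cost_rules cost_foreach[where l = n] cost_tridiagonal_inverse_diagonal[OF assms]
      | (use assms in simp; fail))+)

lemma cost_add_edge:
  assumes "v \<le> n + 1"
  shows "cost (add_edge L u v G) \<le> 16 + n * 31"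
  unfolding add_edge_def
  by (rule order_trans, (rule cost_rules cost_edge_weight[OF assms])+) simp

text \<open>Quadratically many edges, each weighted in linear time. The factor is far above what the rules
  compute.\<close>

lemma cost_construct_digraph:
  "cost (construct_digraph n L) \<le> 1000 * (n + 2) ^ 3"
  unfolding construct_digraph_def
  by (rule order_trans, (rule cost_rules cost_add_edge[where n = n] cost_foreach[where l = "n + 2"] | (auto; fail))+)
    (simp add: algebra_simps power3_eq_cube)

lemma cost_relax:
  assumes "length es \<le> l"
  shows "cost (relax tie m v es s) \<le> 5 + l * 4"
proof (cases es)
  case Nil
  then show ?thesis by (cases s) (simp add: relax_def step_def)
next
  case (Cons e es')
  show ?thesis
    unfolding relax_def Cons list.case candidate_def
    by (rule order_trans, (rule cost_rules cost_foreach[where l = l] | (use assms Cons in simp; fail))+)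
qed

lemma cost_retrieve: "m \<le> l \<Longrightarrow> cost (retrieve \<pi> m v P) \<le> 2 * l + 1"
proof -
  have "cost (retrieve \<pi> m v P) = 2 * m + 1"
    by (induction m arbitrary: v P) (auto simp: bind_tm_def cons_tm_def get_tm_def step_def)
  then show "m \<le> l \<Longrightarrow> cost (retrieve \<pi> m v P) \<le> 2 * l + 1" by simp
qed

text \<open>The retrieved list is traversed by \<open>remove_ends\<close>, so its length enters the operation count.\<close>

lemma length_retrieve: "length (val (retrieve \<pi> m v P)) = m + 1 + length P"
  by (induction m arbitrary: v P) auto

lemma cost_bellman_ford:
  assumes H: "1 \<le> H" "H \<le> n + 1" and degree: "\<And>v. v < n + 2 \<Longrightarrow> length (G v) \<le> n + 1"
  shows "cost (bellman_ford tie tie_end G (n + 2) s t H) \<le> 1000 * (n + 2) ^ 3"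
    and "length (fst (val (bellman_ford tie tie_end G (n + 2) s t H))) \<le> n + 2"
proof -
  have h: "fold (\<lambda>m h. if (if tie_end m h then d (m, t) \<le> d (h, t) else d (m, t) < d (h, t)) then m else h) [2..<H + 1] 1 \<le> n + 1"
    for d :: "nat \<times> nat \<Rightarrow> ereal"
    using best_length(1)[OF H(1), of tie_end d t] H(2) by (simp add: best_length_def)
  show "cost (bellman_ford tie tie_end G (n + 2) s t H) \<le> 1000 * (n + 2) ^ 3"
    unfolding bellman_ford_def
    by (rule order_trans, (rule cost_rules cost_relax[where l = "n + 1"] cost_retrieve[where l = "n + 1"]
        cost_foreach[where l = "n + 2"] | (use h H degree in \<open>simp del: upt_Suc\<close>; fail))+) (simp add: algebra_simps power3_eq_cube)
  show "length (fst (val (bellman_ford tie tie_end G (n + 2) s t H))) \<le> n + 2"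
    using h unfolding bellman_ford_def by (simp add: length_retrieve case_prod_beta del: upt_Suc)
qed

lemma cost_remove_ends: "length P \<le> l \<Longrightarrow> cost (remove_ends s t P) \<le> 1 + l * 4"
  unfolding remove_ends_def
  by (rule order_trans, (rule cost_rules cost_foreach[where l = l] | (simp; fail))+)

lemma cost_leader_selection:
  assumes "1 \<le> k" "k \<le> n"
  shows "cost (leader_selection tie tie_end n \<nu> k) \<le> 100000 * n ^ 3"
proof -
  define G where "G = val (construct_digraph n (val (form_laplacian n \<nu>)))"
  define B where "B = bellman_ford tie tie_end G (n + 2) 0 (n + 1) (k + 1)"
  have degree: "length (G v) \<le> n + 1" if "v < n + 2" for v
    using that assms by (simp add: G_def val_construct_digraph)
  note BF = cost_bellman_ford[of "k + 1" n G tie tie_end 0 "n + 1", folded B_def, OF _ _ degree]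
  have "cost B \<le> 1000 * (n + 2) ^ 3"
    using assms by (intro BF) auto
  moreover have "cost (remove_ends 0 (n + 1) (fst (val B))) \<le> 1 + (n + 2) * 4"
    by (rule cost_remove_ends, rule BF) (use assms in auto)
  moreover have "cost (leader_selection tie tie_end n \<nu> k) =
      cost (form_laplacian n \<nu>) + (cost (construct_digraph n (val (form_laplacian n \<nu>))) +
      (cost B + cost (remove_ends 0 (n + 1) (fst (val B)))))"
    by (simp add: leader_selection_def B_def G_def case_prod_beta bind_tm_def return_def)
  ultimately have "cost (leader_selection tie tie_end n \<nu> k)
      \<le> (2 + n * 14 + n * n * 2) + (1000 * (n + 2) ^ 3 + (1000 * (n + 2) ^ 3 + (1 + (n + 2) * 4)))"
    using cost_form_laplacian[of n \<nu>] cost_construct_digraph[of n "val (form_laplacian n \<nu>)"] by linarith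
  also have "\<dots> \<le> 3000 * (n + 2) ^ 3"
    by (simp add: algebra_simps power3_eq_cube)
  \<comment> \<open>\<open>n + 2 \<le> 3 * n\<close> since \<open>n \<ge> 1\<close>.\<close>
  also have "\<dots> \<le> 3000 * (3 * n) ^ 3"
    using assms by (intro mult_left_mono power_mono) auto
  also have "\<dots> \<le> 100000 * n ^ 3"
    by (simp add: power_mult_distrib)
  finally show ?thesis .
qed

theorem theorem1:
  shows
    "(\<forall>n k \<nu> tie tie_end. 1 \<le> n \<and> 1 \<le> k \<and> noise_weights n \<nu> \<longrightarrow>
        (\<exists>S r. val (leader_selection tie tie_end n \<nu> k) = (S, r) \<and>
          is_arg_min (total_variance n \<nu>) (leader_set n k) (set S) \<and>
          r = ereal (total_variance n \<nu> (set S)))) \<and>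
     (\<exists>C::nat. \<forall>n k \<nu> tie tie_end. 1 \<le> k \<and> k \<le> n \<and> noise_weights n \<nu> \<longrightarrow>
        cost (leader_selection tie tie_end n \<nu> k) \<le> C * n ^ 3)"
proof (rule conjI)
  show "\<forall>n k \<nu> tie tie_end. 1 \<le> n \<and> 1 \<le> k \<and> noise_weights n \<nu> \<longrightarrow>
      (\<exists>S r. val (leader_selection tie tie_end n \<nu> k) = (S, r) \<and>
        is_arg_min (total_variance n \<nu>) (leader_set n k) (set S) \<and>
        r = ereal (total_variance n \<nu> (set S)))"
    using leader_selection_correct by (metis (no_types))
  show "\<exists>C::nat. \<forall>n k \<nu> tie tie_end. 1 \<le> k \<and> k \<le> n \<and> noise_weights n \<nu> \<longrightarrow>
      cost (leader_selection tie tie_end n \<nu> k) \<le> C * n ^ 3"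
    using cost_leader_selection by blast
qed

end
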